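(* Let $\mathcal{P}_4=\{P_n^4 : n\ge 6\}$ be the family of fourth powers of paths and $\mathcal{C}_4=\{C_n^4 : n\ge 9\}$ the family of fourth powers of cycles. Then $BZ(\mathcal{P}_4)=BZ(\mathcal{C}_4)$; that is, both limits below exist and $$\lim_{n\to\infty}\frac{\sum_{T\in\mathcal{T}(P_n^4)}|\mathcal{L}(T)|}{n\cdot\tau(P_n^4)}=\lim_{n\to\infty}\frac{\sum_{T\in\mathcal{T}(C_n^4)}|\mathcal{L}(T)|}{n\cdot\tau(C_n^4)}.$$
   Context: All graphs are finite and simple. $P_n$ and $C_n$ are the path graph and the cycle graph on $n$ vertices. For a graph $G$ and $k\ge1$, the $k$-th power $G^k$ has $V(G^k)=V(G)$, and $uv$ is an edge iff the distance between $u$ and $v$ in $G$ is at least $1$ and at most $k$. $\mathcal{T}(G)$ is the set of labeled spanning trees of $G$, $\tau(G)=|\mathcal{T}(G)|$, and $\mathcal{L}(T)$ is the set of leaves (vertices of degree exactly $1$ in $T$) of a tree $T$. For a graph family $\mathcal{G}$ indexed by number of vertices, with $G_n$ the member on $n$ vertices, the B-Z constant is $BZ(\mathcal{G}):=\lim_{n\to\infty}\frac{\sum_{T\in\mathcal{T}(G_n)}|\mathcal{L}(T)|}{n\,\tau(G_n)}$ whenever the limit exists. *)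

theory Defs
  imports Complex_Main "HOL-Library.Extended_Nat"
begin

text \<open>
  Finite simple undirected graphs, with edges as two-element sets of vertices. The AFP entry
  Graph-Theory is not used: its predicates \<open>forest\<close> and \<open>tree\<close> exclude directed cycles only, and
  there a symmetric digraph with at least one edge is never a forest.
\<close>

record 'a ugraph =
  gverts :: "'a set"
  gedges :: "'a set set"

definition simple_ugraph :: "'a ugraph \<Rightarrow> bool" where
  "simple_ugraph G \<longleftrightarrow> finite (gverts G) \<and> (\<forall>e\<in>gedges G. e \<subseteq> gverts G \<and> card e = 2)"

definition gadj :: "'a ugraph \<Rightarrow> 'a \<Rightarrow> 'a \<Rightarrow> bool" where
  "gadj G u v \<longleftrightarrow> u \<noteq> v \<and> {u, v} \<in> gedges G"

definition gpath :: "'a ugraph \<Rightarrow> 'a \<Rightarrow> 'a list \<Rightarrow> 'a \<Rightarrow> bool" where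
  "gpath G u xs v \<longleftrightarrow> xs \<noteq> [] \<and> hd xs = u \<and> last xs = v \<and> set xs \<subseteq> gverts G \<and>
     distinct xs \<and> successively (gadj G) xs"

text \<open>The infimum of the empty set is \<open>\<infinity>\<close>: the distance between different components.\<close>

definition gdist :: "'a ugraph \<Rightarrow> 'a \<Rightarrow> 'a \<Rightarrow> enat" where
  "gdist G u v = (INF xs\<in>{xs. gpath G u xs v}. enat (length xs - 1))"

definition graph_power :: "'a ugraph \<Rightarrow> nat \<Rightarrow> 'a ugraph" where
  "graph_power G k =
     \<lparr>gverts = gverts G,
      gedges = {{u, v} | u v. u \<in> gverts G \<and> v \<in> gverts G \<and>
                              1 \<le> gdist G u v \<and> gdist G u v \<le> enat k}\<rparr>"

definition gconnected :: "'a ugraph \<Rightarrow> bool" where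
  "gconnected G \<longleftrightarrow> gverts G \<noteq> {} \<and> (\<forall>u\<in>gverts G. \<forall>v\<in>gverts G. \<exists>xs. gpath G u xs v)"

definition gcycle :: "'a ugraph \<Rightarrow> 'a list \<Rightarrow> bool" where
  "gcycle G xs \<longleftrightarrow> length xs \<ge> 3 \<and> set xs \<subseteq> gverts G \<and> distinct xs \<and>
     successively (gadj G) xs \<and> gadj G (last xs) (hd xs)"

definition is_gtree :: "'a ugraph \<Rightarrow> bool" where
  "is_gtree T \<longleftrightarrow> simple_ugraph T \<and> gconnected T \<and> (\<nexists>xs. gcycle T xs)"

definition spanning_gtrees :: "'a ugraph \<Rightarrow> 'a ugraph set" where
  "spanning_gtrees G = {T. gverts T = gverts G \<and> gedges T \<subseteq> gedges G \<and> is_gtree T}"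

definition num_spanning_gtrees :: "'a ugraph \<Rightarrow> nat" where
  "num_spanning_gtrees G = card (spanning_gtrees G)"

definition gdegree :: "'a ugraph \<Rightarrow> 'a \<Rightarrow> nat" where
  "gdegree G v = card {e \<in> gedges G. v \<in> e}"

definition gleaves :: "'a ugraph \<Rightarrow> 'a set" where
  "gleaves T = {v \<in> gverts T. gdegree T v = 1}"

definition path_ugraph :: "nat \<Rightarrow> nat ugraph" where
  "path_ugraph n = \<lparr>gverts = {0..<n}, gedges = {{i, i + 1} | i. i + 1 < n}\<rparr>"

text \<open>This is the cycle on \<open>n\<close> vertices for \<open>n \<ge> 3\<close>; smaller values of \<open>n\<close> are junk.\<close>

definition cycle_ugraph :: "nat \<Rightarrow> nat ugraph" where
  "cycle_ugraph n = \<lparr>gverts = {0..<n}, gedges = {{i, (i + 1) mod n} | i. i < n}\<rparr>"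

text \<open>
  A graph family is a function of the number of vertices. Only its values for large \<open>n\<close> matter
  below, so a family that starts at some \<open>n\<^sub>0\<close> may be given arbitrary values for \<open>n < n\<^sub>0\<close>.
\<close>

definition leaf_ratio :: "(nat \<Rightarrow> 'a ugraph) \<Rightarrow> nat \<Rightarrow> real" where
  "leaf_ratio F n =
     (\<Sum>T\<in>spanning_gtrees (F n). real (card (gleaves T))) / (real n * real (num_spanning_gtrees (F n)))"

text \<open>Meaningful only when \<open>leaf_ratio F\<close> is convergent.\<close>

definition BZ_constant :: "(nat \<Rightarrow> 'a ugraph) \<Rightarrow> real" where
  "BZ_constant F = lim (leaf_ratio F)"

text \<open>The sums and cardinalities above range over finite sets, and the graphs are simple.\<close>

lemma finite_spanning_gtrees:
  assumes "simple_ugraph G"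
  shows "finite (spanning_gtrees G)"
proof -
  have "gedges G \<subseteq> Pow (gverts G)"
    using assms by (auto simp: simple_ugraph_def)
  then have fin: "finite (gedges G)"
    using assms finite_subset by (auto simp: simple_ugraph_def)
  have "spanning_gtrees G \<subseteq> (\<lambda>E. \<lparr>gverts = gverts G, gedges = E\<rparr>) ` Pow (gedges G)"
  proof
    fix T assume "T \<in> spanning_gtrees G"
    then show "T \<in> (\<lambda>E. \<lparr>gverts = gverts G, gedges = E\<rparr>) ` Pow (gedges G)"
      by (intro image_eqI[where x = "gedges T"]) (auto simp: spanning_gtrees_def)
  qed
  then show ?thesis
    using fin finite_subset by blast
qed

lemma gdist_self:
  assumes "u \<in> gverts G"
  shows "gdist G u u = 0"
proof -
  have "gpath G u [u] u"
    using assms by (simp add: gpath_def)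
  then have "gdist G u u \<le> enat (length [u] - 1)"
    unfolding gdist_def by (intro INF_lower) simp
  then show ?thesis
    by (simp add: zero_enat_def[symmetric])
qed

lemma simple_ugraph_power:
  assumes "simple_ugraph G"
  shows "simple_ugraph (graph_power G k)"
proof -
  have "u \<noteq> v" if "u \<in> gverts G" "1 \<le> gdist G u v" for u v
    using that gdist_self[of u G] by auto
  then show ?thesis
    using assms by (fastforce simp: simple_ugraph_def graph_power_def)
qed

lemma simple_path_ugraph: "simple_ugraph (path_ugraph n)"
  by (auto simp: simple_ugraph_def path_ugraph_def)

lemma simple_cycle_ugraph:
  assumes "n \<ge> 3"
  shows "simple_ugraph (cycle_ugraph n)"
proof -
  have "i \<noteq> Suc i mod n" if "i < n" for i
    using assms that by (cases "Suc i = n") auto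
  then show ?thesis
    using assms by (auto simp: simple_ugraph_def cycle_ugraph_def)
qed

end

theory Submission
  imports Defs
begin

text \<open>
  The event that a vertex \<open>v\<close> is a leaf of a uniformly random spanning tree is local: its
  probability depends, up to a small error, only on the graph near \<open>v\<close>. Around a vertex far from
  the two ends, the fourth power of a path looks exactly like the fourth power of a long cycle,
  namely like the graph on the integers in which \<open>i\<close> and \<open>j\<close> are adjacent when
  \<open>0 < \<bar>i - j\<bar> \<le> 4\<close>. The leaf ratio is the average over \<open>v\<close> of the probability that
  \<open>v\<close> is a leaf, so both leaf ratios approach the same number; the vertices near the ends of the
  path are too few to matter.

  Locality is proved with electrical networks. A spanning tree has \<open>v\<close> as a leaf iff it avoids all
  edges at \<open>v\<close> except one, so the leaf probability is a sum of eight quotients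
  \<open>\<tau>(G - D) / \<tau>(G)\<close>, where \<open>D\<close> consists of seven edges at \<open>v\<close>
  (\<open>card_leaf_trees\<close>). Deleting the edges of \<open>D\<close> one at a time reduces this to
  the quotients \<open>\<tau>(G - e) / \<tau>(G)\<close> for a single edge \<open>e = xy\<close>, and these equal
  \<open>C / (1 + C)\<close>, where \<open>C\<close> is the effective conductance between \<open>x\<close> and \<open>y\<close> in
  \<open>G - e\<close>, that is, the least energy of a potential with \<open>f x = 1\<close> and \<open>f y = 0\<close>
  (\<open>effective_conductance_of_trees\<close>). Here the minimising potential is explicit: its value at
  \<open>a\<close> is the probability that \<open>a\<close> lies on the side of \<open>x\<close> when \<open>e\<close> is removed from
  a random spanning tree through \<open>e\<close>. An exchange of edges between the trees that contain
  \<open>e\<close> and the trees that do not shows that this potential obeys Kirchhoff's laws for a current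
  that enters at \<open>x\<close> and leaves at \<open>y\<close> (\<open>unit_current\<close>).

  Finally, the effective conductance is local because the graphs are essentially one-dimensional. Take
  the optimal potential of one graph, multiply it by a cutoff that decreases linearly from \<open>1\<close> at
  the centre to \<open>0\<close> at distance \<open>N\<close>, and transplant it to another graph that agrees with
  the first one up to distance \<open>N\<close>. The cutoff changes by \<open>O(1/N)\<close> along each edge and there
  are \<open>O(N)\<close> edges, so the extra energy is about \<open>N \<cdot> 1/N\<^sup>2\<close>, which tends to zero
  (\<open>transplant\<close>). By symmetry the two conductances are close to each other.
\<close>

section \<open>Trees as edge sets\<close>

definition adj_pairs :: "'a set set \<Rightarrow> ('a \<times> 'a) set" where
  "adj_pairs T = {(a, b). {a, b} \<in> T}"

abbreviation reach :: "'a set set \<Rightarrow> ('a \<times> 'a) set" where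
  "reach T \<equiv> (adj_pairs T)\<^sup>*"

definition connects :: "'a set set \<Rightarrow> 'a set \<Rightarrow> bool" where
  "connects T V \<longleftrightarrow> (\<forall>u\<in>V. \<forall>v\<in>V. (u, v) \<in> reach T)"

text \<open>
  Acyclicity is expressed by every edge being a bridge; this form, unlike a statement about closed
  walks, is stable under the exchange of edges used below.
\<close>

definition all_bridges :: "'a set set \<Rightarrow> bool" where
  "all_bridges T \<longleftrightarrow> (\<forall>a b. {a, b} \<in> T \<longrightarrow> (a, b) \<notin> reach (T - {{a, b}}))"

definition tree_sets :: "'a set \<Rightarrow> 'a set set \<Rightarrow> 'a set set set" where
  "tree_sets V E = {T. T \<subseteq> E \<and> connects T V \<and> all_bridges T}"

lemma reach_mono: "S \<subseteq> T \<Longrightarrow> reach S \<subseteq> reach T"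
  by (intro rtrancl_mono) (auto simp: adj_pairs_def)

lemma reach_sym: "(a, b) \<in> reach T \<Longrightarrow> (b, a) \<in> reach T"
proof -
  have "sym (adj_pairs T)" by (auto simp: sym_def adj_pairs_def insert_commute)
  then show "(a, b) \<in> reach T \<Longrightarrow> (b, a) \<in> reach T"
    by (meson sym_rtrancl symD)
qed

lemma reach_edge: "{a, b} \<in> T \<Longrightarrow> (a, b) \<in> reach T"
  by (auto simp: adj_pairs_def)

text \<open>
  A walk that uses a new edge enters it at one end and leaves it at the other, and only the first and
  the last such moment count.
\<close>

lemma reach_insert:
  assumes "(a, b) \<in> reach (insert {z, w} S)"
  shows "(a, b) \<in> reach S \<or> (a, z) \<in> reach S \<and> (w, b) \<in> reach S
    \<or> (a, w) \<in> reach S \<and> (z, b) \<in> reach S"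
  using assms
proof (induction rule: rtrancl_induct)
  case base
  then show ?case by simp
next
  case (step b c)
  then consider "{b, c} \<in> S" | "b = z" "c = w" | "b = w" "c = z"
    by (auto simp: adj_pairs_def doubleton_eq_iff)
  then show ?case
  proof cases
    case 1
    then have "(b, c) \<in> reach S" by (rule reach_edge)
    with step.IH show ?thesis by (meson rtrancl_trans)
  qed (use step.IH in auto)
qed

lemma side_cases:
  assumes "connects T V" "{x, y} \<in> T" "x \<in> V" "u \<in> V"
  shows "(x, u) \<in> reach (T - {{x, y}}) \<or> (y, u) \<in> reach (T - {{x, y}})"
proof -
  have "insert {x, y} (T - {{x, y}}) = T" using assms by auto
  moreover have "(x, u) \<in> reach T" using assms by (auto simp: connects_def)
  ultimately show ?thesis using reach_insert[of x u x y "T - {{x, y}}"] by auto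
qed

lemma side_disjoint:
  assumes "all_bridges T" "{x, y} \<in> T" "(x, u) \<in> reach (T - {{x, y}})"
  shows "(y, u) \<notin> reach (T - {{x, y}})"
  using assms by (meson all_bridges_def reach_sym rtrancl_trans)

text \<open>
  Removing \<open>{x, y}\<close> from a tree leaves two components, and any pair \<open>{z, w}\<close> that joins
  them restores a tree.
\<close>

lemma tree_exchange:
  assumes T: "connects T V" "all_bridges T" and xy: "{x, y} \<in> T" "x \<in> V"
    and z: "(x, z) \<in> reach (T - {{x, y}})" and w: "(y, w) \<in> reach (T - {{x, y}})"
  shows "{z, w} \<notin> T - {{x, y}}"
    and "connects (insert {z, w} (T - {{x, y}})) V"
    and "all_bridges (insert {z, w} (T - {{x, y}}))"
proof -
  define S where "S = T - {{x, y}}"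
  have sep: "\<not> ((x, u) \<in> reach S \<and> (y, u) \<in> reach S)" for u
    using side_disjoint[OF T(2) xy(1)] by (auto simp: S_def)
  show zw: "{z, w} \<notin> T - {{x, y}}"
  proof
    assume "{z, w} \<in> T - {{x, y}}"
    then have "(z, w) \<in> reach S" unfolding S_def by (rule reach_edge)
    with z w sep show False by (metis S_def rtrancl_trans)
  qed
  have mono: "reach S \<subseteq> reach (insert {z, w} S)" by (rule reach_mono) auto
  have zw': "(z, w) \<in> reach (insert {z, w} S)" by (rule reach_edge) auto
  have "(x, u) \<in> reach (insert {z, w} S)" if "u \<in> V" for u
  proof -
    have "(x, y) \<in> reach (insert {z, w} S)"
      using z w mono zw' by (metis S_def reach_sym rtrancl_trans subsetD)
    then show ?thesis
      using side_cases[OF T(1) xy that] mono by (metis S_def rtrancl_trans subsetD)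
  qed
  then show "connects (insert {z, w} (T - {{x, y}})) V"
    unfolding connects_def S_def[symmetric] by (meson reach_sym rtrancl_trans)
  have "(a, b) \<notin> reach (insert {z, w} S - {{a, b}})" if ab: "{a, b} \<in> insert {z, w} S" for a b
  proof (cases "{a, b} = {z, w}")
    case True
    have "insert {z, w} S - {{a, b}} = S" using True zw by (auto simp: S_def)
    moreover have "(z, w) \<notin> reach S" using z w sep by (metis S_def rtrancl_trans)
    ultimately show ?thesis using True by (metis doubleton_eq_iff reach_sym)
  next
    case False
    then have ab: "{a, b} \<in> S" using ab by auto
    show ?thesis
    proof
      assume "(a, b) \<in> reach (insert {z, w} S - {{a, b}})"
      moreover have "insert {z, w} S - {{a, b}} = insert {z, w} (S - {{a, b}})"
        using False by auto
      ultimately consider "(a, b) \<in> reach (S - {{a, b}})"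
        | "(a, z) \<in> reach (S - {{a, b}})" "(w, b) \<in> reach (S - {{a, b}})"
        | "(a, w) \<in> reach (S - {{a, b}})" "(z, b) \<in> reach (S - {{a, b}})"
        using reach_insert[of a b z w "S - {{a, b}}"] by auto
      then show False
      proof cases
        case 1
        moreover have "S - {{a, b}} \<subseteq> T - {{a, b}}" by (auto simp: S_def)
        ultimately show False
          using T(2) ab reach_mono unfolding all_bridges_def S_def by blast
      next
        \<comment> \<open>The ends \<open>a\<close>, \<open>b\<close> would lie on different sides of \<open>{x, y}\<close>, although \<open>{a, b}\<close> joins them.\<close>
        case 2
        moreover have "reach (S - {{a, b}}) \<subseteq> reach S" by (rule reach_mono) auto
        moreover have "(a, b) \<in> reach S" using ab by (rule reach_edge)
        ultimately have "(z, w) \<in> reach S" by (meson reach_sym rtrancl_trans subsetD)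
        then show False using z w sep by (metis S_def rtrancl_trans)
      next
        case 3
        moreover have "reach (S - {{a, b}}) \<subseteq> reach S" by (rule reach_mono) auto
        moreover have "(a, b) \<in> reach S" using ab by (rule reach_edge)
        ultimately have "(z, w) \<in> reach S" by (meson reach_sym rtrancl_trans subsetD)
        then show False using z w sep by (metis S_def rtrancl_trans)
      qed
    qed
  qed
  then show "all_bridges (insert {z, w} (T - {{x, y}}))"
    unfolding all_bridges_def S_def[symmetric] by blast
qed

text \<open>
  As long as some edge is not a bridge, it can be dropped without losing connectedness.
\<close>

lemma tree_sets_exist:
  assumes "finite E" "connects E V"
  shows "tree_sets V E \<noteq> {}"
  using assms
proof (induction "card E" arbitrary: E rule: less_induct)
  case less
  show ?case
  proof (cases "all_bridges E")
    case True
    with less.prems show ?thesis by (auto simp: tree_sets_def)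
  next
    case False
    then obtain a b where ab: "{a, b} \<in> E" "(a, b) \<in> reach (E - {{a, b}})"
      by (auto simp: all_bridges_def)
    let ?E = "E - {{a, b}}"
    have "adj_pairs E \<subseteq> reach ?E"
    proof
      fix p assume "p \<in> adj_pairs E"
      then obtain c d where p: "p = (c, d)" "{c, d} \<in> E" by (auto simp: adj_pairs_def)
      show "p \<in> reach ?E"
      proof (cases "{c, d} = {a, b}")
        case True
        then show ?thesis using ab reach_sym p by (auto simp: doubleton_eq_iff)
      next
        case False
        then show ?thesis using p by (auto intro: reach_edge)
      qed
    qed
    then have "reach E \<subseteq> reach ?E" by (metis rtrancl_subset_rtrancl)
    then have "connects ?E V" using less.prems by (auto simp: connects_def)
    then have "tree_sets V ?E \<noteq> {}"
      using less ab by (metis card_Diff1_less finite_Diff)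
    then show ?thesis by (auto simp: tree_sets_def)
  qed
qed

section \<open>Paths\<close>

definition simple_path :: "'a set set \<Rightarrow> 'a \<Rightarrow> 'a list \<Rightarrow> 'a \<Rightarrow> bool" where
  "simple_path T u xs v \<longleftrightarrow> xs \<noteq> [] \<and> hd xs = u \<and> last xs = v \<and> distinct xs \<and>
     successively (\<lambda>a b. {a, b} \<in> T) xs"

text \<open>
  The bound on the length lets this lemma serve for distances as well as for connectedness.
\<close>

lemma simple_path_of_relpow:
  assumes "(u, v) \<in> adj_pairs T ^^ k"
  shows "\<exists>xs. simple_path T u xs v \<and> length xs \<le> k + 1"
  using assms
proof (induction k arbitrary: v)
  case 0
  then show ?case by (intro exI[of _ "[u]"]) (auto simp: simple_path_def)
next
  case (Suc k)
  then obtain w where w: "(u, w) \<in> adj_pairs T ^^ k" "{w, v} \<in> T" by (auto simp: adj_pairs_def)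
  obtain xs where xs: "simple_path T u xs w" "length xs \<le> k + 1" using Suc.IH[OF w(1)] by blast
  show ?case
  proof (cases "v \<in> set xs")
    case True
    then obtain ys zs where "xs = ys @ v # zs" by (meson split_list)
    then have "simple_path T u (ys @ [v]) v \<and> length (ys @ [v]) \<le> Suc k + 1"
      using xs by (auto simp: simple_path_def successively_append_iff hd_append)
    then show ?thesis by blast
  next
    case False
    then have "simple_path T u (xs @ [v]) v \<and> length (xs @ [v]) \<le> Suc k + 1"
      using xs w(2) by (auto simp: simple_path_def successively_append_iff)
    then show ?thesis by blast
  qed
qed

lemma simple_path_of_reach:
  assumes "(u, v) \<in> reach T"
  obtains xs where "simple_path T u xs v"
  using assms simple_path_of_relpow by (metis rtrancl_power)

lemma reach_of_walk:
  assumes "xs \<noteq> []" "successively (\<lambda>a b. {a, b} \<in> T) xs"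
  shows "(hd xs, last xs) \<in> reach T"
  using assms
proof (induction xs rule: induct_list012)
  case (3 a b xs)
  then have "(b, last (b # xs)) \<in> reach T" "(a, b) \<in> reach T" by (auto intro: reach_edge)
  then show ?case by (metis last_ConsR list.discI list.sel(1) rtrancl_trans)
qed auto

lemma sum_along_walk:
  fixes h :: "'a \<Rightarrow> real"
  assumes "xs \<noteq> []"
  shows "(\<Sum>(a, b)\<leftarrow>zip xs (tl xs). h a - h b) = h (hd xs) - h (last xs)"
  using assms by (induction xs rule: induct_list012) auto

lemma zip_tl_split:
  assumes "(a, b) \<in> set (zip xs (tl xs))"
  shows "\<exists>ys zs. xs = ys @ a # b # zs"
  using assms
proof (induction xs rule: induct_list012)
  case (3 c d xs)
  then consider "a = c" "b = d" | "(a, b) \<in> set (zip (d # xs) (tl (d # xs)))" by auto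
  then show ?case
  proof cases
    case 1
    then show ?thesis by (intro exI[of _ "[]"] exI[of _ xs]) auto
  next
    case 2
    then obtain ys zs where "d # xs = ys @ a # b # zs" using 3 by auto
    then show ?thesis by (metis append_Cons)
  qed
qed auto

text \<open>
  The directed edges of the path from \<open>x\<close> to \<open>y\<close> in a tree \<open>T\<close>, described without
  the path: \<open>a\<close> lies on the side of \<open>x\<close> and \<open>b\<close> on the side of \<open>y\<close> when
  \<open>{a, b}\<close> is removed. This is the form in which they come out of the exchange of edges.
\<close>

definition path_steps :: "'a set set \<Rightarrow> 'a \<Rightarrow> 'a \<Rightarrow> ('a \<times> 'a) set" where
  "path_steps T x y = {(a, b). {a, b} \<in> T \<and> (a, x) \<in> reach (T - {{a, b}}) \<and> (b, y) \<in> reach (T - {{a, b}})}"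

lemma successively_del_edge:
  assumes "successively (\<lambda>a b. {a, b} \<in> T) xs" "\<not> {c, d} \<subseteq> set xs"
  shows "successively (\<lambda>a b. {a, b} \<in> T - {{c, d}}) xs"
  using assms by (induction xs rule: induct_list012) (auto simp: doubleton_eq_iff)

text \<open>
  A step of the path splits it into two pieces that avoid the step, which puts its ends on the right
  sides. Conversely, an edge that is not traversed by the path, or only backwards, would have both ends
  connected after its removal if it separated \<open>x\<close> from \<open>y\<close> as required.
\<close>

lemma path_steps_of_simple_path:
  assumes "all_bridges T" "simple_path T x xs y"
  shows "path_steps T x y = set (zip xs (tl xs))"
proof -
  have xs: "xs \<noteq> []" "hd xs = x" "last xs = y" "distinct xs"
    "successively (\<lambda>a b. {a, b} \<in> T) xs"
    using assms(2) by (auto simp: simple_path_def)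
  have sub: "(a, b) \<in> path_steps T x y" if step: "(a, b) \<in> set (zip xs (tl xs))" for a b
  proof -
    obtain ys zs where eq: "xs = ys @ a # b # zs" using zip_tl_split[OF step] by blast
    have "successively (\<lambda>a b. {a, b} \<in> T) (ys @ [a])" "successively (\<lambda>a b. {a, b} \<in> T) (b # zs)"
      "{a, b} \<in> T"
      using xs(5) by (auto simp: eq successively_append_iff successively_Cons)
    moreover have "\<not> {a, b} \<subseteq> set (ys @ [a])" "\<not> {a, b} \<subseteq> set (b # zs)"
      using xs(4) by (auto simp: eq)
    ultimately have "(hd (ys @ [a]), last (ys @ [a])) \<in> reach (T - {{a, b}})"
      "(hd (b # zs), last (b # zs)) \<in> reach (T - {{a, b}})"
      using successively_del_edge reach_of_walk by (metis Nil_is_append_conv list.discI)+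
    moreover have "hd (ys @ [a]) = x" "last (b # zs) = y"
      using xs(2,3) by (auto simp: eq hd_append)
    ultimately show ?thesis
      using \<open>{a, b} \<in> T\<close> by (auto simp: path_steps_def intro: reach_sym)
  qed
  have "(a, b) \<in> set (zip xs (tl xs))" if ab: "(a, b) \<in> path_steps T x y" for a b
  proof (rule ccontr)
    assume non: "(a, b) \<notin> set (zip xs (tl xs))"
    have ab: "{a, b} \<in> T" "(a, x) \<in> reach (T - {{a, b}})" "(b, y) \<in> reach (T - {{a, b}})"
      using ab by (auto simp: path_steps_def)
    have nab: "(a, b) \<notin> reach (T - {{a, b}})" using assms(1) ab(1) by (auto simp: all_bridges_def)
    show False
    proof (cases "(b, a) \<in> set (zip xs (tl xs))")
      case True
      then have "(b, x) \<in> reach (T - {{a, b}})"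
        using sub[OF True] by (auto simp: path_steps_def insert_commute)
      then show False using nab ab(2) by (meson reach_sym rtrancl_trans)
    next
      case False
      have "successively (\<lambda>a' b'. {a', b'} \<in> T - {{a, b}}) xs"
        using xs(5) False non
        by (induction xs rule: induct_list012) (auto simp: doubleton_eq_iff)
      then have "(x, y) \<in> reach (T - {{a, b}})" using reach_of_walk xs(1-3) by metis
      then show False using nab ab by (meson reach_sym rtrancl_trans)
    qed
  qed
  then show ?thesis using sub by auto
qed

text \<open>
  The steps of a path carry a unit flow: differences of \<open>h\<close> along them telescope.
\<close>

lemma sum_path_steps:
  fixes h :: "'a \<Rightarrow> real"
  assumes "all_bridges T" "(x, y) \<in> reach T"
  shows "(\<Sum>(a, b)\<in>path_steps T x y. h a - h b) = h x - h y"
proof -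
  obtain xs where xs: "simple_path T x xs y" using simple_path_of_reach assms(2) by metis
  note eq = path_steps_of_simple_path[OF assms(1) xs]
  have "distinct (zip xs (tl xs))" using xs by (simp add: simple_path_def distinct_zipI1)
  then have "(\<Sum>(a, b)\<in>path_steps T x y. h a - h b) = (\<Sum>(a, b)\<leftarrow>zip xs (tl xs). h a - h b)"
    by (simp add: eq sum_list_distinct_conv_sum_set)
  then show "(\<Sum>(a, b)\<in>path_steps T x y. h a - h b) = h x - h y"
    using sum_along_walk xs by (metis simple_path_def)
qed

section \<open>The voltage of a random spanning tree\<close>

text \<open>
  Every edge occurs in both directions in \<open>adj_pairs\<close>, so this is twice the usual Dirichlet
  energy. The factor \<open>2\<close> reappears wherever energies are compared with conductances.
\<close>

definition energy :: "'a set set \<Rightarrow> ('a \<Rightarrow> real) \<Rightarrow> real" where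
  "energy E f = (\<Sum>(a, b)\<in>adj_pairs E. (f a - f b)\<^sup>2)"

lemma finite_adj_pairs:
  assumes "finite V" "\<And>e. e \<in> E \<Longrightarrow> e \<subseteq> V"
  shows "finite (adj_pairs E)"
proof (rule finite_subset)
  show "adj_pairs E \<subseteq> V \<times> V" using assms(2) by (fastforce simp: adj_pairs_def)
qed (use assms(1) in simp)

lemma finite_tree_sets: "finite E \<Longrightarrow> finite (tree_sets V E)"
  by (rule finite_subset[of _ "Pow E"]) (auto simp: tree_sets_def)

lemma tree_sets_mono: "D \<subseteq> E \<Longrightarrow> tree_sets V D \<subseteq> tree_sets V E"
  by (auto simp: tree_sets_def)

definition trees_with :: "'a set \<Rightarrow> 'a set set \<Rightarrow> 'a set \<Rightarrow> 'a set set set" where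
  "trees_with V E e = {T \<in> tree_sets V E. e \<in> T}"

text \<open>
  For a uniformly random spanning tree through \<open>{x, y}\<close>, this is the probability that \<open>a\<close>
  stays connected to \<open>x\<close> when \<open>{x, y}\<close> is removed.
\<close>

definition voltage :: "'a set \<Rightarrow> 'a set set \<Rightarrow> 'a \<Rightarrow> 'a \<Rightarrow> 'a \<Rightarrow> real" where
  "voltage V E x y a =
     real (card {T \<in> trees_with V E {x, y}. (x, a) \<in> reach (T - {{x, y}})}) / real (card (trees_with V E {x, y}))"

lemma tree_sets_split:
  assumes "finite E"
  shows "card (tree_sets V E) = card (tree_sets V (E - {e})) + card (trees_with V E e)"
proof -
  have "tree_sets V E = tree_sets V (E - {e}) \<union> trees_with V E e"
    by (auto simp: tree_sets_def trees_with_def)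
  moreover have "tree_sets V (E - {e}) \<inter> trees_with V E e = {}"
    by (auto simp: tree_sets_def trees_with_def)
  moreover have "finite (tree_sets V (E - {e}))" "finite (trees_with V E e)"
    using assms by (auto simp: trees_with_def finite_tree_sets)
  ultimately show ?thesis by (simp add: card_Un_disjoint)
qed

lemma insert_swap_back:
  assumes "e \<in> T" "e' \<notin> T - {e}"
  shows "insert e (insert e' (T - {e}) - {e'}) = T"
  using assms by blast

text \<open>
  On the left are trees through \<open>{x, y}\<close> with a directed edge that crosses from the side of
  \<open>x\<close> to the side of \<open>y\<close>; on the right are trees that avoid \<open>{x, y}\<close> with a step of
  their path from \<open>x\<close> to \<open>y\<close>. Both kinds of pairs describe a spanning forest with two
  components that separate \<open>x\<close> from \<open>y\<close>, together with an edge that joins these components.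
\<close>

lemma exchange_bij:
  assumes E: "{x, y} \<in> E" "\<And>e. e \<in> E \<Longrightarrow> e \<subseteq> V"
  shows "bij_betw (\<lambda>(T, a, b). (insert {a, b} (T - {{x, y}}), a, b))
    (SIGMA T:trees_with V E {x, y}. {(a, b). {a, b} \<in> E - {{x, y}} \<and>
        (x, a) \<in> reach (T - {{x, y}}) \<and> (y, b) \<in> reach (T - {{x, y}})})
    (SIGMA T:tree_sets V (E - {{x, y}}). path_steps T x y)" (is "bij_betw ?f ?A ?B")
proof (rule bij_betw_byWitness[where f' = "\<lambda>(T, a, b). (insert {x, y} (T - {{a, b}}), a, b)"])
  have V: "x \<in> V" "y \<in> V" using E by auto
  have fwd: "insert {a, b} (T - {{x, y}}) \<in> tree_sets V (E - {{x, y}})"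
    "(a, b) \<in> path_steps (insert {a, b} (T - {{x, y}})) x y" "{a, b} \<notin> T - {{x, y}}" "{x, y} \<in> T"
    if "(T, a, b) \<in> ?A" for T a b
  proof -
    have T: "connects T V" "all_bridges T" "T \<subseteq> E" "{x, y} \<in> T"
      and ab: "{a, b} \<in> E - {{x, y}}" "(x, a) \<in> reach (T - {{x, y}})" "(y, b) \<in> reach (T - {{x, y}})"
      using that by (auto simp: trees_with_def tree_sets_def)
    note ex = tree_exchange[OF T(1,2,4) V(1) ab(2,3)]
    show "insert {a, b} (T - {{x, y}}) \<in> tree_sets V (E - {{x, y}})"
      using ex T ab by (auto simp: tree_sets_def)
    have "insert {a, b} (T - {{x, y}}) - {{a, b}} = T - {{x, y}}" using ex(1) by auto
    then show "(a, b) \<in> path_steps (insert {a, b} (T - {{x, y}})) x y"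
      using ab by (auto simp: path_steps_def intro: reach_sym)
    show "{a, b} \<notin> T - {{x, y}}" "{x, y} \<in> T" by fact+
  qed
  have bwd: "(insert {x, y} (T - {{a, b}}), a, b) \<in> ?A" "{x, y} \<notin> T - {{a, b}}" "{a, b} \<in> T"
    if "(T, a, b) \<in> ?B" for T a b
  proof -
    have T: "connects T V" "all_bridges T" "T \<subseteq> E - {{x, y}}"
      and ab: "{a, b} \<in> T" "(a, x) \<in> reach (T - {{a, b}})" "(b, y) \<in> reach (T - {{a, b}})"
      using that by (auto simp: tree_sets_def path_steps_def)
    have "a \<in> V" using ab(1) T(3) E(2)[of "{a, b}"] by auto
    note ex = tree_exchange[OF T(1,2) ab(1) this ab(2,3)]
    have "insert {x, y} (T - {{a, b}}) - {{x, y}} = T - {{a, b}}" using ex(1) by auto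
    then show "(insert {x, y} (T - {{a, b}}), a, b) \<in> ?A"
      using ex T ab E(1) by (auto simp: tree_sets_def trees_with_def intro: reach_sym)
    show "{x, y} \<notin> T - {{a, b}}" "{a, b} \<in> T" using T(3) ab(1) by auto
  qed
  show "\<forall>p\<in>?A. (\<lambda>(T, a, b). (insert {x, y} (T - {{a, b}}), a, b)) (?f p) = p"
  proof
    fix p assume p: "p \<in> ?A"
    obtain T a b where [simp]: "p = (T, a, b)" by (cases p) auto
    show "(\<lambda>(T, a, b). (insert {x, y} (T - {{a, b}}), a, b)) (?f p) = p"
      using insert_swap_back[OF fwd(4,3)[of T a b]] p by simp
  qed
  show "\<forall>p\<in>?B. ?f ((\<lambda>(T, a, b). (insert {x, y} (T - {{a, b}}), a, b)) p) = p"
  proof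
    fix p assume p: "p \<in> ?B"
    obtain T a b where [simp]: "p = (T, a, b)" by (cases p) auto
    show "?f ((\<lambda>(T, a, b). (insert {x, y} (T - {{a, b}}), a, b)) p) = p"
      using insert_swap_back[OF bwd(3,2)[of T a b]] p by simp
  qed
  show "?f ` ?A \<subseteq> ?B"
  proof
    fix q assume "q \<in> ?f ` ?A"
    then obtain T a b where q: "(T, a, b) \<in> ?A" "q = (insert {a, b} (T - {{x, y}}), a, b)"
      by force
    show "q \<in> ?B" unfolding q(2) using fwd(1,2)[OF q(1)] by blast
  qed
  show "(\<lambda>(T, a, b). (insert {x, y} (T - {{a, b}}), a, b)) ` ?B \<subseteq> ?A"
  proof
    fix q assume "q \<in> (\<lambda>(T, a, b). (insert {x, y} (T - {{a, b}}), a, b)) ` ?B"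
    then obtain T a b where q: "(T, a, b) \<in> ?B" "q = (insert {x, y} (T - {{a, b}}), a, b)"
      by force
    show "q \<in> ?A" unfolding q(2) using bwd(1)[OF q(1)] by blast
  qed
qed

text \<open>
  Kirchhoff's laws for the voltage, tested against an arbitrary potential \<open>h\<close>. After multiplication
  by the number of trees through \<open>{x, y}\<close>, the left side becomes a sum over these trees and their
  crossing edges. The exchange bijection turns it into a sum over the trees that avoid \<open>{x, y}\<close>
  and the steps of their paths, where it telescopes.
\<close>

lemma unit_current:
  fixes h :: "'a \<Rightarrow> real"
  assumes V: "finite V" and E: "{x, y} \<in> E" "\<And>e. e \<in> E \<Longrightarrow> e \<subseteq> V"
  defines "N \<equiv> real (card (trees_with V E {x, y}))"
  shows "(\<Sum>(a, b)\<in>adj_pairs (E - {{x, y}}). N * (voltage V E x y a - voltage V E x y b) * (h a - h b))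
    = 2 * real (card (tree_sets V (E - {{x, y}}))) * (h x - h y)"
proof -
  let ?W = "trees_with V E {x, y}" and ?H = "adj_pairs (E - {{x, y}})"
  have finE: "finite E" by (rule finite_subset[of _ "Pow V"]) (use V E in auto)
  have finW: "finite ?W" using finE by (simp add: trees_with_def finite_tree_sets)
  have finH: "finite ?H" using V E by (intro finite_adj_pairs[of V]) auto
  define s where "s T a = (if (x, a) \<in> reach (T - {{x, y}}) then 1 else 0 :: real)" for T a
  define cross where "cross T = {(a, b). {a, b} \<in> E - {{x, y}} \<and>
        (x, a) \<in> reach (T - {{x, y}}) \<and> (y, b) \<in> reach (T - {{x, y}})}" for T
  have Nv: "N * voltage V E x y a = (\<Sum>T\<in>?W. s T a)" for a
  proof -
    have "(\<Sum>T\<in>?W. s T a) = real (card {T \<in> ?W. (x, a) \<in> reach (T - {{x, y}})})"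
      using finW by (simp add: s_def sum.If_cases Int_def)
    moreover have "card {T \<in> ?W. (x, a) \<in> reach (T - {{x, y}})} = 0" if "card ?W = 0"
      using that finW by auto
    ultimately show ?thesis by (auto simp: voltage_def N_def)
  qed
  \<comment> \<open>For a single tree, only the edges that cross between its two sides contribute, and the two
    directions of such an edge contribute the same amount.\<close>
  have tree: "(\<Sum>(a, b)\<in>?H. (s T a - s T b) * (h a - h b)) = 2 * (\<Sum>(a, b)\<in>cross T. h a - h b)"
    if T: "T \<in> ?W" for T
  proof -
    have T': "connects T V" "all_bridges T" "{x, y} \<in> T"
      using T by (auto simp: trees_with_def tree_sets_def)
    have x: "x \<in> V" using E by auto
    have y_side: "(y, a) \<in> reach (T - {{x, y}}) \<longleftrightarrow> (x, a) \<notin> reach (T - {{x, y}})" if "a \<in> V" for a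
      using side_cases[OF T'(1,3) x that] side_disjoint[OF T'(2,3)] by blast
    have cross: "cross T = {(a, b) \<in> ?H. s T a = 1 \<and> s T b = 0}"
    proof -
      have "b \<in> V" if "{a, b} \<in> E" for a b using E(2)[OF that] by auto
      then show ?thesis using y_side by (auto simp: cross_def adj_pairs_def s_def split: if_splits)
    qed
    have fin: "finite (cross T)" by (rule finite_subset[OF _ finH]) (auto simp: cross)
    have cross': "prod.swap ` cross T = {(a, b) \<in> ?H. s T a = 0 \<and> s T b = 1}"
      unfolding cross by (force simp: adj_pairs_def insert_commute)
    have "(\<Sum>(a, b)\<in>?H. (s T a - s T b) * (h a - h b))
      = (\<Sum>(a, b)\<in>cross T \<union> prod.swap ` cross T. (s T a - s T b) * (h a - h b))"
      unfolding cross' using finH by (intro sum.mono_neutral_right) (auto simp: cross s_def split: if_splits)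
    also have "\<dots> = (\<Sum>(a, b)\<in>cross T. (s T a - s T b) * (h a - h b))
      + (\<Sum>(a, b)\<in>prod.swap ` cross T. (s T a - s T b) * (h a - h b))"
      using fin by (intro sum.union_disjoint) (auto simp: cross)
    also have "(\<Sum>(a, b)\<in>prod.swap ` cross T. (s T a - s T b) * (h a - h b))
      = (\<Sum>(a, b)\<in>cross T. (s T b - s T a) * (h b - h a))"
      by (subst sum.reindex) (auto intro!: inj_onI sum.cong simp: prod.swap_def split: prod.splits)
    also have "(\<Sum>(a, b)\<in>cross T. (s T a - s T b) * (h a - h b)) = (\<Sum>(a, b)\<in>cross T. h a - h b)"
      by (rule sum.cong) (auto simp: cross)
    also have "(\<Sum>(a, b)\<in>cross T. (s T b - s T a) * (h b - h a)) = (\<Sum>(a, b)\<in>cross T. h a - h b)"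
      by (rule sum.cong) (auto simp: cross)
    finally show ?thesis by simp
  qed
  have fin_cross: "finite (cross T)" for T
    by (rule finite_subset[OF _ finH]) (auto simp: cross_def adj_pairs_def)
  have fin_steps: "\<forall>T\<in>tree_sets V (E - {{x, y}}). finite (path_steps T x y)"
    by (intro ballI finite_subset[OF _ finH]) (auto simp: tree_sets_def path_steps_def adj_pairs_def)
  have fin0: "finite (tree_sets V (E - {{x, y}}))" using finE by (simp add: finite_tree_sets)
  have "(\<Sum>(a, b)\<in>?H. N * (voltage V E x y a - voltage V E x y b) * (h a - h b))
    = (\<Sum>(a, b)\<in>?H. \<Sum>T\<in>?W. (s T a - s T b) * (h a - h b))"
    by (rule sum.cong) (auto simp: right_diff_distrib Nv sum_subtractf[symmetric] sum_distrib_right left_diff_distrib)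
  also have "\<dots> = (\<Sum>T\<in>?W. \<Sum>(a, b)\<in>?H. (s T a - s T b) * (h a - h b))"
    by (subst sum.swap) (simp add: case_prod_unfold)
  also have "\<dots> = 2 * (\<Sum>T\<in>?W. \<Sum>(a, b)\<in>cross T. h a - h b)"
    by (simp add: tree sum_distrib_left)
  also have "(\<Sum>T\<in>?W. \<Sum>(a, b)\<in>cross T. h a - h b)
    = (\<Sum>(T, a, b)\<in>Sigma ?W cross. h a - h b)"
    by (rule sum.Sigma) (use finW fin_cross in auto)
  also have "\<dots> = (\<Sum>(T, a, b)\<in>(SIGMA T:tree_sets V (E - {{x, y}}). path_steps T x y). h a - h b)"
    using sum.reindex_bij_betw[OF exchange_bij[OF E], of "\<lambda>(T, a, b). h a - h b"]
    by (simp add: cross_def[abs_def] case_prod_unfold)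
  also have "\<dots> = (\<Sum>T\<in>tree_sets V (E - {{x, y}}). \<Sum>(a, b)\<in>path_steps T x y. h a - h b)"
    by (rule sum.Sigma[symmetric]) (use fin0 fin_steps in auto)
  also have "\<dots> = (\<Sum>T\<in>tree_sets V (E - {{x, y}}). h x - h y)"
  proof (rule sum.cong)
    fix T assume "T \<in> tree_sets V (E - {{x, y}})"
    moreover have "x \<in> V" "y \<in> V" using E by auto
    ultimately show "(\<Sum>(a, b)\<in>path_steps T x y. h a - h b) = h x - h y"
      by (intro sum_path_steps) (auto simp: tree_sets_def connects_def)
  qed simp
  finally show ?thesis by simp
qed

text \<open>
  Dirichlet's principle used as a definition: \<open>2 * C\<close> is the minimum of the energy over potentials
  with drop \<open>1\<close> from \<open>x\<close> to \<open>y\<close>. The bounds \<open>0\<close> and \<open>1\<close> on a minimiser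
  are recorded because the energy spent on cutting a potential off grows with its size.
\<close>

definition effective_conductance :: "'a set set \<Rightarrow> 'a \<Rightarrow> 'a \<Rightarrow> real \<Rightarrow> bool" where
  "effective_conductance H x y C \<longleftrightarrow> C \<ge> 0 \<and>
     (\<exists>f. (\<forall>a. 0 \<le> f a \<and> f a \<le> 1) \<and> f x = 1 \<and> f y = 0 \<and> energy H f = 2 * C) \<and>
     (\<forall>g. g x - g y = 1 \<longrightarrow> 2 * C \<le> energy H g)"

text \<open>
  The conductance is the number of trees that avoid \<open>{x, y}\<close> divided by the number of trees through
  it, and the voltage is the minimiser: by \<open>unit_current\<close>, the voltage has the same mixed energy with
  every admissible potential as with itself, so an admissible potential \<open>g\<close> exceeds it in energy by
  the energy of their difference.
\<close>

lemma effective_conductance_of_trees: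
  assumes V: "finite V" and E: "{x, y} \<in> E" "x \<noteq> y" "\<And>e. e \<in> E \<Longrightarrow> e \<subseteq> V"
    and conn: "connects (E - {{x, y}}) V"
  obtains C where "effective_conductance (E - {{x, y}}) x y C"
    and "real (card (tree_sets V (E - {{x, y}}))) = C / (1 + C) * real (card (tree_sets V E))"
proof -
  let ?H = "adj_pairs (E - {{x, y}})" and ?v = "voltage V E x y" and ?W = "trees_with V E {x, y}"
  define N where "N = real (card ?W)"
  define M where "M = real (card (tree_sets V (E - {{x, y}})))"
  have finE: "finite E" by (rule finite_subset[of _ "Pow V"]) (use V E in auto)
  have finH: "finite ?H" using V E by (intro finite_adj_pairs[of V]) auto
  have finW: "finite ?W" using finE by (simp add: trees_with_def finite_tree_sets)
  have M: "M > 0"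
    using tree_sets_exist[OF _ conn] finE by (simp add: M_def card_gt_0_iff finite_tree_sets)
  have cur: "(\<Sum>(a, b)\<in>?H. N * (?v a - ?v b) * (h a - h b)) = 2 * M * (h x - h y)" for h
    using unit_current[OF V E(1,3), of h] by (simp add: N_def M_def)
  \<comment> \<open>If no tree contained \<open>{x, y}\<close>, the current identity would have left side \<open>0\<close>, whereas
    its right side counts the trees that avoid \<open>{x, y}\<close>, of which there is at least one.\<close>
  have N: "N > 0"
  proof (rule ccontr)
    assume "\<not> N > 0"
    then have "N = 0" by (simp add: N_def)
    then show False using cur[of "\<lambda>a. if a = x then 1 else 0"] M E(2) by simp
  qed
  have cur': "(\<Sum>(a, b)\<in>?H. (?v a - ?v b) * (h a - h b)) = 2 * (M / N) * (h x - h y)" for h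
  proof -
    have "N * (\<Sum>(a, b)\<in>?H. (?v a - ?v b) * (h a - h b)) = 2 * M * (h x - h y)"
      using cur[of h] by (simp add: sum_distrib_left case_prod_unfold mult.assoc)
    then show ?thesis using N by (simp add: field_simps)
  qed
  have vx: "?v x = 1" using N by (simp add: voltage_def N_def)
  have vy: "?v y = 0"
  proof -
    have "{T \<in> ?W. (x, y) \<in> reach (T - {{x, y}})} = {}"
      by (auto simp: trees_with_def tree_sets_def all_bridges_def)
    then show ?thesis unfolding voltage_def by (simp only: card.empty)
  qed
  have v01: "0 \<le> ?v a \<and> ?v a \<le> 1" for a
    using N finW by (auto simp: voltage_def N_def divide_le_eq intro!: card_mono)
  have en_v: "energy (E - {{x, y}}) ?v = 2 * (M / N)"
    using cur'[of ?v] by (simp add: energy_def power2_eq_square vx vy)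
  have min: "2 * (M / N) \<le> energy (E - {{x, y}}) g" if g: "g x - g y = 1" for g
  proof -
    have "0 \<le> (\<Sum>(a, b)\<in>?H. ((g a - g b) - (?v a - ?v b))\<^sup>2)" by (auto intro: sum_nonneg)
    also have "\<dots> = (\<Sum>(a, b)\<in>?H. (g a - g b)\<^sup>2 + (?v a - ?v b)\<^sup>2 - 2 * ((?v a - ?v b) * (g a - g b)))"
      by (rule sum.cong) (auto simp: power2_diff)
    also have "\<dots> = energy (E - {{x, y}}) g + energy (E - {{x, y}}) ?v
      - 2 * (\<Sum>(a, b)\<in>?H. (?v a - ?v b) * (g a - g b))"
      by (simp add: energy_def case_prod_unfold sum_subtractf sum.distrib sum_distrib_left)
    finally show ?thesis using cur'[of g] g en_v by simp
  qed
  have "real (card (tree_sets V E)) = M + N"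
    using tree_sets_split[OF finE, of V "{x, y}"] by (simp add: M_def N_def)
  then have "M = (M / N) / (1 + M / N) * real (card (tree_sets V E))"
    using M N by (simp add: field_simps add_pos_pos)
  then show thesis
    using that[of "M / N"] M N v01 vx vy en_v min
    unfolding M_def[symmetric] effective_conductance_def by (metis divide_nonneg_pos less_imp_le)
qed

section \<open>Transplanting potentials between graphs that share a window\<close>

definition offsets :: "int set" where "offsets = {-4..4} - {0}"

definition star :: "(int \<Rightarrow> 'a) \<Rightarrow> int set \<Rightarrow> 'a set set" where
  "star \<phi> S = (\<lambda>s. {\<phi> 0, \<phi> s}) ` S"

text \<open>
  Near \<open>\<phi> 0\<close> the graph is the fourth power of a two-way infinite path. Vertices with index between
  \<open>-N\<close> and \<open>N\<close> have all their neighbours in the image of \<open>\<phi>\<close>; the \<open>4\<close> further indices on each side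
  provide these neighbours.
\<close>

definition window :: "'a set set \<Rightarrow> (int \<Rightarrow> 'a) \<Rightarrow> int \<Rightarrow> bool" where
  "window E \<phi> N \<longleftrightarrow> inj_on \<phi> {-N-4..N+4} \<and>
     (\<forall>i\<in>{-N-4..N+4}. \<forall>j\<in>{-N-4..N+4}. {\<phi> i, \<phi> j} \<in> E \<longleftrightarrow> i \<noteq> j \<and> \<bar>i - j\<bar> \<le> 4) \<and>
     (\<forall>i\<in>{-N..N}. \<forall>b. {\<phi> i, b} \<in> E \<longrightarrow> b \<in> \<phi> ` {-N-4..N+4})"

definition window_pairs :: "int \<Rightarrow> int set \<Rightarrow> (int \<times> int) set" where
  "window_pairs N S = {(i, j). i \<in> {-N-4..N+4} \<and> j \<in> {-N-4..N+4} \<and> i \<noteq> j \<and> \<bar>i - j\<bar> \<le> 4 \<and>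
     {i, j} \<notin> (\<lambda>s. {0, s}) ` S}"

lemma window_edge_iff:
  assumes W: "window E \<phi> N" and N: "N \<ge> 0" and S: "S \<subseteq> offsets"
    and ij: "i \<in> {-N-4..N+4}" "j \<in> {-N-4..N+4}"
  shows "{\<phi> i, \<phi> j} \<in> E - star \<phi> S \<longleftrightarrow> (i, j) \<in> window_pairs N S"
proof -
  have inj: "inj_on \<phi> {-N-4..N+4}" using W by (simp add: window_def)
  have S': "S \<subseteq> {-N-4..N+4}" using S N by (auto simp: offsets_def)
  have "{\<phi> i, \<phi> j} = {\<phi> 0, \<phi> s} \<longleftrightarrow> {i, j} = {0, s}" if "s \<in> S" for s
  proof -
    have "s \<in> {-N-4..N+4}" "0 \<in> {-N-4..N+4}" using that S' N by auto
    then have "\<phi> ` {i, j} = \<phi> ` {0, s} \<longleftrightarrow> {i, j} = {0, s}"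
      using ij by (intro inj_on_image_eq_iff[OF inj]) auto
    then show ?thesis by simp
  qed
  then have "{\<phi> i, \<phi> j} \<in> star \<phi> S \<longleftrightarrow> {i, j} \<in> (\<lambda>s. {0, s}) ` S"
    by (auto simp: star_def image_iff)
  moreover have "{\<phi> i, \<phi> j} \<in> E \<longleftrightarrow> i \<noteq> j \<and> \<bar>i - j\<bar> \<le> 4"
    using W ij by (auto simp: window_def)
  ultimately show ?thesis using ij by (auto simp: window_pairs_def)
qed

lemma card_window_pairs:
  assumes "N \<ge> 9"
  shows "finite (window_pairs N S)" and "real (card (window_pairs N S)) \<le> 27 * real_of_int N"
proof -
  have sub: "window_pairs N S \<subseteq> (SIGMA i:{-N-4..N+4}. {i-4..i+4})"
    by (auto simp: window_pairs_def)
  then show "finite (window_pairs N S)" by (rule finite_subset) auto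
  have "card (window_pairs N S) \<le> card (SIGMA i:{-N-4..N+4}. {i-4..i+4})"
    using sub by (intro card_mono) auto
  also have "\<dots> = nat (2 * N + 9) * 9" by simp
  finally show "real (card (window_pairs N S)) \<le> 27 * real_of_int N" using assms by linarith
qed

text \<open>
  Splitting the square with a factor \<open>1 + t\<close> close to \<open>1\<close> on the main term is what makes the
  transplanted energy asymptotically equal to, rather than merely bounded by a multiple of, the original.
\<close>

lemma square_sum_le:
  fixes u v t :: real
  assumes "t > 0"
  shows "(u + v)\<^sup>2 \<le> (1 + t) * u\<^sup>2 + (1 + 1 / t) * v\<^sup>2"
proof -
  have "0 \<le> (t * u - v)\<^sup>2 / t" using assms by simp
  also have "\<dots> = t * u\<^sup>2 - 2 * u * v + v\<^sup>2 / t"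
    using assms by (simp add: power2_diff field_simps power2_eq_square)
  finally show ?thesis by (simp add: power2_sum algebra_simps)
qed

text \<open>
  The transplanted potential is \<open>\<eta> i * f (\<phi> i)\<close> on the window and \<open>0\<close> elsewhere, with the
  cutoff \<open>\<eta> i = max 0 (1 - \<bar>i\<bar> / N)\<close>. Since it vanishes where the window has edges
  to the rest of the graph, the rest contributes no energy. The product with \<open>\<eta>\<close> keeps the value at the
  centre, and it keeps the value at a neighbour \<open>\<phi> s\<close> if that value is \<open>0\<close>, so the
  boundary conditions of Dirichlet's principle survive. The cutoff changes by at most \<open>4 / N\<close> along each
  of at most \<open>27 N\<close> directed edges, and \<open>27 N * (4 / N)\<^sup>2 = 432 / N\<close>.
\<close>

lemma transplant:
  fixes f :: "'a \<Rightarrow> real" and \<phi> :: "int \<Rightarrow> 'a" and \<phi>' :: "int \<Rightarrow> 'b"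
  assumes W: "window E \<phi> N" "window E' \<phi>' N" and N: "N \<ge> 9" and S: "S \<subseteq> offsets" and t: "t > 0"
    and fin: "finite (adj_pairs E)" "finite (adj_pairs E')"
    and f: "\<And>a. 0 \<le> f a \<and> f a \<le> 1"
  obtains g where "g (\<phi>' 0) = f (\<phi> 0)" and "\<And>s. s \<in> offsets \<Longrightarrow> f (\<phi> s) = 0 \<Longrightarrow> g (\<phi>' s) = 0"
    and "energy (E' - star \<phi>' S) g \<le> (1 + t) * energy (E - star \<phi> S) f + (1 + 1 / t) * 432 / N"
proof -
  define I where "I = {-N-4..N+4}"
  define \<eta> :: "int \<Rightarrow> real" where "\<eta> i = max 0 (1 - \<bar>i\<bar> / N)" for i
  define g where "g a = (if a \<in> \<phi>' ` I then let i = the_inv_into I \<phi>' a in \<eta> i * f (\<phi> i) else 0)" for a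
  let ?P = "window_pairs N S"
  have inj: "inj_on \<phi> I" "inj_on \<phi>' I" using W by (auto simp: window_def I_def)
  have P: "?P \<subseteq> I \<times> I" by (auto simp: window_pairs_def I_def)
  have g: "g (\<phi>' i) = \<eta> i * f (\<phi> i)" if "i \<in> I" for i
    using that inj by (simp add: g_def the_inv_into_f_f)
  have \<eta>0: "\<eta> i = 0" if "\<bar>i\<bar> \<ge> N" for i using that N by (simp add: \<eta>_def field_simps)
  have "map_prod \<phi>' \<phi>' ` ?P \<subseteq> adj_pairs (E' - star \<phi>' S)"
    using window_edge_iff[OF W(2) _ S] N by (auto simp: adj_pairs_def window_pairs_def)
  \<comment> \<open>An edge that does not come from the window has both ends where \<open>g\<close> vanishes.\<close>
  moreover have "g a = g b" if ab: "(a, b) \<in> adj_pairs (E' - star \<phi>' S) - map_prod \<phi>' \<phi>' ` ?P" for a b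
  proof -
    have key: "g c = 0" if cd: "{c, d} \<in> E' - star \<phi>' S" "(c, d) \<notin> map_prod \<phi>' \<phi>' ` ?P" for c d
    proof (cases "c \<in> \<phi>' ` {-N..N}")
      case True
      then obtain i where i: "c = \<phi>' i" "i \<in> {-N..N}" by blast
      then obtain j where j: "d = \<phi>' j" "j \<in> I"
        using W(2) cd(1) unfolding window_def I_def by blast
      have "i \<in> I" using i by (auto simp: I_def)
      then have "(i, j) \<in> ?P"
        using window_edge_iff[OF W(2) _ S, of i j] cd(1) i j N by (auto simp: I_def)
      then show ?thesis using cd(2) i j by force
    next
      case False
      show ?thesis
      proof (cases "c \<in> \<phi>' ` I")
        case True
        then obtain i where i: "c = \<phi>' i" "i \<in> I" by blast
        then have "\<bar>i\<bar> \<ge> N" using False by (auto simp: image_iff) (smt (verit) atLeastAtMost_iff)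
        then show ?thesis using g i \<eta>0 by simp
      qed (simp add: g_def)
    qed
    have "(b, a) \<notin> map_prod \<phi>' \<phi>' ` ?P"
      using ab by (force simp: window_pairs_def insert_commute)
    then show ?thesis
      using key[of a b] key[of b a] ab by (auto simp: adj_pairs_def insert_commute)
  qed
  moreover have "finite (adj_pairs (E' - star \<phi>' S))"
    by (rule finite_subset[OF _ fin(2)]) (auto simp: adj_pairs_def)
  ultimately have "energy (E' - star \<phi>' S) g = (\<Sum>(a, b)\<in>map_prod \<phi>' \<phi>' ` ?P. (g a - g b)\<^sup>2)"
    unfolding energy_def by (intro sum.mono_neutral_right) auto
  also have "\<dots> = (\<Sum>(i, j)\<in>?P. (g (\<phi>' i) - g (\<phi>' j))\<^sup>2)"
  proof -
    have "inj_on (map_prod \<phi>' \<phi>') ?P"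
      by (rule inj_on_subset[OF map_prod_inj_on[OF inj(2) inj(2)] P])
    then show ?thesis by (subst sum.reindex) (auto simp: case_prod_unfold)
  qed
  also have "\<dots> \<le> (\<Sum>(i, j)\<in>?P. (1 + t) * (f (\<phi> i) - f (\<phi> j))\<^sup>2 + (1 + 1 / t) * (4 / N)\<^sup>2)"
  proof (rule sum_mono, clarify)
    fix i j assume ij: "(i, j) \<in> ?P"
    then have I: "i \<in> I" "j \<in> I" "\<bar>i - j\<bar> \<le> 4" using P by (auto simp: window_pairs_def)
    have \<eta>: "\<bar>\<eta> k\<bar> \<le> 1" for k using N by (simp add: \<eta>_def)
    have lip: "\<bar>max 0 (1 - p) - max 0 (1 - q)\<bar> \<le> \<bar>p - q\<bar>" for p q :: real
      by (auto simp: max_def)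
    have "\<bar>\<eta> i - \<eta> j\<bar> \<le> \<bar>real_of_int \<bar>i\<bar> / N - real_of_int \<bar>j\<bar> / N\<bar>"
      using lip[of "\<bar>i\<bar> / N" "\<bar>j\<bar> / N"] by (simp add: \<eta>_def)
    also have "\<dots> = \<bar>real_of_int (\<bar>i\<bar> - \<bar>j\<bar>)\<bar> / N" using N by (simp add: diff_divide_distrib[symmetric])
    also have "\<dots> \<le> 4 / N" using N I(3) by (intro divide_right_mono) linarith+
    finally have d\<eta>: "\<bar>\<eta> i - \<eta> j\<bar> \<le> 4 / N" .
    define u v where "u = \<eta> i * (f (\<phi> i) - f (\<phi> j))" and "v = (\<eta> i - \<eta> j) * f (\<phi> j)"
    have "(g (\<phi>' i) - g (\<phi>' j))\<^sup>2 = (u + v)\<^sup>2" using I by (simp add: g u_def v_def algebra_simps)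
    also have "\<dots> \<le> (1 + t) * u\<^sup>2 + (1 + 1 / t) * v\<^sup>2" by (rule square_sum_le[OF t])
    also have "\<dots> \<le> (1 + t) * (f (\<phi> i) - f (\<phi> j))\<^sup>2 + (1 + 1 / t) * (4 / N)\<^sup>2"
    proof (intro add_mono mult_left_mono)
      show "u\<^sup>2 \<le> (f (\<phi> i) - f (\<phi> j))\<^sup>2"
        unfolding u_def abs_le_square_iff[symmetric] abs_mult using \<eta>[of i] by (intro mult_left_le_one_le) auto
      have "\<bar>v\<bar> \<le> \<bar>\<eta> i - \<eta> j\<bar>" using f[of "\<phi> j"] by (simp add: v_def abs_mult mult_left_le)
      then show "v\<^sup>2 \<le> (4 / N)\<^sup>2" using d\<eta> by (metis abs_le_square_iff abs_of_nonneg order_trans abs_ge_zero)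
    qed (use t in auto)
    finally show "(g (\<phi>' i) - g (\<phi>' j))\<^sup>2 \<le> \<dots>" .
  qed
  also have "\<dots> = (1 + t) * (\<Sum>(i, j)\<in>?P. (f (\<phi> i) - f (\<phi> j))\<^sup>2) + real (card ?P) * ((1 + 1 / t) * (4 / N)\<^sup>2)"
    by (simp add: case_prod_unfold sum.distrib sum_distrib_left)
  also have "\<dots> \<le> (1 + t) * energy (E - star \<phi> S) f + 27 * real_of_int N * ((1 + 1 / t) * (4 / N)\<^sup>2)"
  proof (intro add_mono mult_left_mono mult_right_mono)
    have "(\<Sum>(i, j)\<in>?P. (f (\<phi> i) - f (\<phi> j))\<^sup>2) = (\<Sum>(a, b)\<in>map_prod \<phi> \<phi> ` ?P. (f a - f b)\<^sup>2)"
      using inj_on_subset[OF map_prod_inj_on[OF inj(1) inj(1)] P]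
      by (subst sum.reindex) (auto simp: case_prod_unfold)
    also have "\<dots> \<le> energy (E - star \<phi> S) f"
      unfolding energy_def
    proof (intro sum_mono2)
      show "finite (adj_pairs (E - star \<phi> S))"
        by (rule finite_subset[OF _ fin(1)]) (auto simp: adj_pairs_def)
      show "map_prod \<phi> \<phi> ` ?P \<subseteq> adj_pairs (E - star \<phi> S)"
        using window_edge_iff[OF W(1) _ S] N by (auto simp: adj_pairs_def window_pairs_def)
    qed auto
    finally show "(\<Sum>(i, j)\<in>?P. (f (\<phi> i) - f (\<phi> j))\<^sup>2) \<le> energy (E - star \<phi> S) f" .
    show "real (card ?P) \<le> 27 * real_of_int N" using N by (rule card_window_pairs)
  qed (use t in auto)
  also have "27 * real_of_int N * ((1 + 1 / t) * (4 / N)\<^sup>2) = (1 + 1 / t) * 432 / N"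
    using N by (simp add: power2_eq_square field_simps)
  finally have en: "energy (E' - star \<phi>' S) g \<le> (1 + t) * energy (E - star \<phi> S) f + (1 + 1 / t) * 432 / N" .
  show thesis
  proof (rule that[OF _ _ en])
    show "g (\<phi>' 0) = f (\<phi> 0)" using g[of 0] N by (simp add: \<eta>_def I_def)
    show "g (\<phi>' s) = 0" if "s \<in> offsets" "f (\<phi> s) = 0" for s
      using g[of s] that N by (auto simp: I_def offsets_def)
  qed
qed

section \<open>Comparing tree counts\<close>

definition windowed :: "'a set \<Rightarrow> 'a set set \<Rightarrow> (int \<Rightarrow> 'a) \<Rightarrow> int \<Rightarrow> bool" where
  "windowed V E \<phi> N \<longleftrightarrow> finite V \<and> (\<forall>e\<in>E. e \<subseteq> V) \<and> connects E V \<and> window E \<phi> N"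

text \<open>
  If at least one edge at \<open>\<phi> 0\<close> remains, every deleted edge at \<open>\<phi> 0\<close> has a detour: the
  neighbours of \<open>\<phi> 0\<close> are connected among themselves, across the centre through the edge between
  \<open>\<phi> (-1)\<close> and \<open>\<phi> 1\<close>.
\<close>

lemma connects_del_star:
  assumes W: "windowed V E \<phi> N" and N: "N \<ge> 9" and S: "S \<subset> offsets"
  shows "connects (E - star \<phi> S) V"
proof -
  let ?H = "E - star \<phi> S"
  have win: "window E \<phi> N" using W by (simp add: windowed_def)
  have edge: "(\<phi> i, \<phi> j) \<in> reach ?H"
    if "i \<in> offsets" "j \<in> offsets" "\<bar>i - j\<bar> \<le> 4" for i j
  proof (cases "i = j")
    case False
    have ij: "i \<noteq> 0" "j \<noteq> 0" "\<bar>i\<bar> \<le> 4" "\<bar>j\<bar> \<le> 4" using that by (auto simp: offsets_def)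
    have "0 \<in> e" if "e \<in> (\<lambda>s. {0, s}) ` S" for e using that by auto
    from this[of "{i, j}"] have "{i, j} \<notin> (\<lambda>s. {0, s}) ` S" using ij(1,2) by auto
    then have "(i, j) \<in> window_pairs N S"
      using ij that(3) False N by (simp add: window_pairs_def) arith
    then show ?thesis
      using window_edge_iff[OF win _ , of S i j] S N by (intro reach_edge) (auto simp: window_pairs_def)
  qed simp
  have to_one: "(\<phi> s, \<phi> 1) \<in> reach ?H" if "s \<in> offsets" for s
  proof (cases "s > 0")
    case True
    then show ?thesis using that by (intro edge) (auto simp: offsets_def)
  next
    case False
    then have "(\<phi> s, \<phi> (-1)) \<in> reach ?H" using that by (intro edge) (auto simp: offsets_def)
    moreover have "(\<phi> (-1), \<phi> 1) \<in> reach ?H" by (intro edge) (auto simp: offsets_def)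
    ultimately show ?thesis by (rule rtrancl_trans)
  qed
  obtain s0 where s0: "s0 \<in> offsets" "s0 \<notin> S" using S by blast
  have "(0, s0) \<in> window_pairs N S"
    using s0 N by (auto simp: window_pairs_def offsets_def doubleton_eq_iff)
  then have "(\<phi> 0, \<phi> s0) \<in> reach ?H"
    using window_edge_iff[OF win _, of S 0 s0] S N by (intro reach_edge) (auto simp: window_pairs_def)
  then have center: "(\<phi> 0, \<phi> s) \<in> reach ?H" if "s \<in> offsets" for s
    using to_one[OF s0(1)] to_one[OF that] by (meson reach_sym rtrancl_trans)
  have "adj_pairs E \<subseteq> reach ?H"
  proof
    fix p assume "p \<in> adj_pairs E"
    then obtain a b where p: "p = (a, b)" "{a, b} \<in> E" by (auto simp: adj_pairs_def)
    show "p \<in> reach ?H"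
    proof (cases "{a, b} \<in> star \<phi> S")
      case True
      then obtain s where s: "s \<in> S" "{a, b} = {\<phi> 0, \<phi> s}" by (auto simp: star_def)
      then have "(\<phi> 0, \<phi> s) \<in> reach ?H" using center S by auto
      then show ?thesis using s p by (auto simp: doubleton_eq_iff intro: reach_sym)
    next
      case False
      then show ?thesis using p by (auto intro: reach_edge)
    qed
  qed
  then have "reach E \<subseteq> reach ?H" by (metis rtrancl_subset_rtrancl)
  then show ?thesis using W by (auto simp: windowed_def connects_def)
qed

definition deleted_ratio :: "'a set \<Rightarrow> 'a set set \<Rightarrow> (int \<Rightarrow> 'a) \<Rightarrow> int set \<Rightarrow> real" where
  "deleted_ratio V E \<phi> S = real (card (tree_sets V (E - star \<phi> S))) / real (card (tree_sets V E))"

lemma windowed_finite: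
  assumes "windowed V E \<phi> N"
  shows "finite E" "finite (adj_pairs E)" "card (tree_sets V E) > 0"
proof -
  have "E \<subseteq> Pow V" "finite V" using assms by (auto simp: windowed_def)
  then show "finite E" by (meson finite_Pow_iff finite_subset)
  then show "card (tree_sets V E) > 0"
    using assms tree_sets_exist by (auto simp: windowed_def card_gt_0_iff finite_tree_sets)
  show "finite (adj_pairs E)" using assms by (intro finite_adj_pairs[of V]) (auto simp: windowed_def)
qed

lemma deleted_ratio_bounds:
  assumes "windowed V E \<phi> N"
  shows "0 \<le> deleted_ratio V E \<phi> S" "deleted_ratio V E \<phi> S \<le> 1"
proof -
  have "card (tree_sets V (E - star \<phi> S)) \<le> card (tree_sets V E)"
    using windowed_finite[OF assms] by (intro card_mono finite_tree_sets tree_sets_mono) auto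
  then show "0 \<le> deleted_ratio V E \<phi> S" "deleted_ratio V E \<phi> S \<le> 1"
    using windowed_finite(3)[OF assms] by (auto simp: deleted_ratio_def divide_le_eq)
qed

lemma deleted_ratio_insert:
  assumes W: "windowed V E \<phi> N" and N: "N \<ge> 9" and S: "insert s S \<subset> offsets" "s \<notin> S"
  obtains C where "effective_conductance (E - star \<phi> (insert s S)) (\<phi> 0) (\<phi> s) C"
    and "deleted_ratio V E \<phi> (insert s S) = C / (1 + C) * deleted_ratio V E \<phi> S"
proof -
  have win: "window E \<phi> N" and V: "finite V" "\<And>e. e \<in> E \<Longrightarrow> e \<subseteq> V" using W by (auto simp: windowed_def)
  have eq: "E - star \<phi> S - {{\<phi> 0, \<phi> s}} = E - star \<phi> (insert s S)" by (auto simp: star_def)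
  have "(0, s) \<in> window_pairs N S"
    using S N by (auto simp: window_pairs_def offsets_def doubleton_eq_iff)
  then have e: "{\<phi> 0, \<phi> s} \<in> E - star \<phi> S"
    using window_edge_iff[OF win _, of S 0 s] S N by (auto simp: window_pairs_def)
  have ne: "\<phi> 0 \<noteq> \<phi> s"
  proof -
    have "0 \<in> {-N-4..N+4}" "s \<in> {-N-4..N+4}" "s \<noteq> 0" using S N by (auto simp: offsets_def)
    moreover have "inj_on \<phi> {-N-4..N+4}" using win by (simp add: window_def)
    ultimately show ?thesis by (metis inj_onD)
  qed
  obtain C where "effective_conductance (E - star \<phi> (insert s S)) (\<phi> 0) (\<phi> s) C"
    and "real (card (tree_sets V (E - star \<phi> (insert s S)))) = C / (1 + C) * real (card (tree_sets V (E - star \<phi> S)))"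
    using effective_conductance_of_trees[OF V(1) e ne] connects_del_star[OF W N S(1)] V(2)
    unfolding eq by (metis DiffD1)
  then show thesis by (intro that) (simp_all add: deleted_ratio_def)
qed

lemma conductance_le:
  assumes W: "windowed V E \<phi> N" "windowed V' E' \<phi>' N" and N: "N \<ge> 9" and S: "S \<subseteq> offsets" "s \<in> S"
    and t: "t > 0"
    and C: "effective_conductance (E - star \<phi> S) (\<phi> 0) (\<phi> s) C"
    and C': "effective_conductance (E' - star \<phi>' S) (\<phi>' 0) (\<phi>' s) C'"
  shows "C' \<le> (1 + t) * C + (1 + 1 / t) * 216 / N"
proof -
  obtain f where f: "\<And>a. 0 \<le> f a \<and> f a \<le> 1" "f (\<phi> 0) = 1" "f (\<phi> s) = 0"
    "energy (E - star \<phi> S) f = 2 * C" using C by (auto simp: effective_conductance_def)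
  obtain g where g: "g (\<phi>' 0) = f (\<phi> 0)" "\<And>s. s \<in> offsets \<Longrightarrow> f (\<phi> s) = 0 \<Longrightarrow> g (\<phi>' s) = 0"
    "energy (E' - star \<phi>' S) g \<le> (1 + t) * energy (E - star \<phi> S) f + (1 + 1 / t) * 432 / N"
    using transplant[of E \<phi> N E' \<phi>' S t f] W windowed_finite(2)[OF W(1)] windowed_finite(2)[OF W(2)] N S t f(1)
    by (auto simp: windowed_def)
  define r where "r = (1 + t) * C + (1 + 1 / t) * 216 / N"
  have "g (\<phi>' 0) - g (\<phi>' s) = 1" using g f S by auto
  then have "2 * C' \<le> energy (E' - star \<phi>' S) g" using C' by (auto simp: effective_conductance_def)
  also have "\<dots> \<le> (1 + t) * (2 * C) + (1 + 1 / t) * 432 / N" using g(3) f(4) by simp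
  also have "\<dots> = 2 * r" by (simp add: r_def algebra_simps)
  finally show ?thesis unfolding r_def[symmetric] by simp
qed

text \<open>
  The map \<open>C \<mapsto> C / (1 + C)\<close> turns a relative error into an absolute one, which makes the bound
  uniform in the conductances.
\<close>

lemma odds_ratio_le:
  fixes C C' t d :: real
  assumes "C \<ge> 0" "C' \<ge> 0" "C' \<le> (1 + t) * C + d" "t \<ge> 0" "d \<ge> 0"
  shows "C' / (1 + C') - C / (1 + C) \<le> t + d"
proof -
  have "C' - C \<le> (t + d) * (1 + C)" using assms by (simp add: algebra_simps) (smt (verit) mult_nonneg_nonneg)
  also have "\<dots> \<le> (t + d) * ((1 + C) * (1 + C'))"
    using assms by (intro mult_left_mono) (auto simp: algebra_simps)
  finally have "(C' - C) / ((1 + C) * (1 + C')) \<le> t + d" using assms by (subst pos_divide_le_eq) auto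
  moreover have "C' / (1 + C') - C / (1 + C) = (C' - C) / ((1 + C) * (1 + C'))"
    using assms by (simp add: field_simps)
  ultimately show ?thesis by simp
qed

text \<open>
  Deleting the edges one at a time writes the quotient as a product of factors \<open>C / (1 + C)\<close> in the unit
  interval, and the errors of the factors add up.
\<close>

lemma deleted_ratio_close:
  assumes W: "windowed V E \<phi> N" "windowed V' E' \<phi>' N" and N: "N \<ge> 9" and S: "S \<subset> offsets" and t: "t > 0"
  shows "\<bar>deleted_ratio V E \<phi> S - deleted_ratio V' E' \<phi>' S\<bar> \<le> real (card S) * (t + (1 + 1 / t) * 216 / N)"
proof -
  have "finite S" using S by (auto simp: offsets_def intro: finite_subset)
  then show ?thesis using S
  proof (induction S)
    case empty
    then show ?case
      using windowed_finite(3)[OF W(1)] windowed_finite(3)[OF W(2)]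
      by (simp add: deleted_ratio_def star_def)
  next
    case (insert s S)
    define d where "d = (1 + 1 / t) * 216 / real_of_int N"
    obtain C where C: "effective_conductance (E - star \<phi> (insert s S)) (\<phi> 0) (\<phi> s) C"
      "deleted_ratio V E \<phi> (insert s S) = C / (1 + C) * deleted_ratio V E \<phi> S"
      using deleted_ratio_insert[OF W(1) N insert.prems insert.hyps(2)] .
    obtain C' where C': "effective_conductance (E' - star \<phi>' (insert s S)) (\<phi>' 0) (\<phi>' s) C'"
      "deleted_ratio V' E' \<phi>' (insert s S) = C' / (1 + C') * deleted_ratio V' E' \<phi>' S"
      using deleted_ratio_insert[OF W(2) N insert.prems insert.hyps(2)] .
    have pos: "C \<ge> 0" "C' \<ge> 0" using C C' by (auto simp: effective_conductance_def)
    have d: "d \<ge> 0" using t N by (simp add: d_def)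
    have sub: "insert s S \<subseteq> offsets" using insert.prems by auto
    have "C' \<le> (1 + t) * C + d" by (unfold d_def, rule conductance_le[OF W N sub _ t C(1) C'(1)]) simp
    moreover have "C \<le> (1 + t) * C' + d" by (unfold d_def, rule conductance_le[OF W(2,1) N sub _ t C'(1) C(1)]) simp
    ultimately have "\<bar>C / (1 + C) - C' / (1 + C')\<bar> \<le> t + d"
      using odds_ratio_le[of C C' t d] odds_ratio_le[of C' C t d] pos d t by auto
    moreover have "\<bar>deleted_ratio V E \<phi> S - deleted_ratio V' E' \<phi>' S\<bar> \<le> real (card S) * (t + d)"
      unfolding d_def using insert.IH sub insert.hyps insert.prems by blast
    moreover have "\<bar>a * q - a' * q'\<bar> \<le> \<bar>a - a'\<bar> + \<bar>q - q'\<bar>"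
      if "0 \<le> a" "a \<le> 1" "0 \<le> q'" "q' \<le> 1" for a a' q q' :: real
    proof -
      have "a * q - a' * q' = a * (q - q') + (a - a') * q'" by (simp add: algebra_simps)
      also have "\<bar>\<dots>\<bar> \<le> \<bar>a * (q - q')\<bar> + \<bar>(a - a') * q'\<bar>" by (rule abs_triangle_ineq)
      also have "\<dots> \<le> \<bar>q - q'\<bar> + \<bar>a - a'\<bar>"
        using that by (intro add_mono) (auto simp: abs_mult mult_left_le_one_le mult_left_le)
      finally show ?thesis by simp
    qed
    from this[of "C / (1 + C)" "deleted_ratio V' E' \<phi>' S" "deleted_ratio V E \<phi> S" "C' / (1 + C')"]
    have "\<bar>deleted_ratio V E \<phi> (insert s S) - deleted_ratio V' E' \<phi>' (insert s S)\<bar>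
      \<le> \<bar>C / (1 + C) - C' / (1 + C')\<bar> + \<bar>deleted_ratio V E \<phi> S - deleted_ratio V' E' \<phi>' S\<bar>"
      using pos deleted_ratio_bounds[OF W(2)] by (simp add: C(2) C'(2) divide_le_eq)
    moreover have "real (card (insert s S)) * (t + d) = (t + d) + real (card S) * (t + d)"
      using insert.hyps by (simp add: algebra_simps)
    ultimately show ?case unfolding d_def[symmetric] by linarith
  qed
qed

definition leaf_trees :: "'a set \<Rightarrow> 'a set set \<Rightarrow> 'a \<Rightarrow> 'a set set set" where
  "leaf_trees V E v = {T \<in> tree_sets V E. card {e \<in> T. v \<in> e} = 1}"

text \<open>
  The vertex \<open>\<phi> 0\<close> is a leaf attached through \<open>{\<phi> 0, \<phi> s}\<close> exactly when the tree avoids the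
  other seven edges at \<open>\<phi> 0\<close>; a tree that avoids them contains the remaining one since it is
  connected.
\<close>

lemma card_leaf_trees:
  assumes W: "windowed V E \<phi> N" and N: "N \<ge> 9" and card2: "\<And>e. e \<in> E \<Longrightarrow> card e = 2"
  shows "card (leaf_trees V E (\<phi> 0)) = (\<Sum>s\<in>offsets. card (tree_sets V (E - star \<phi> (offsets - {s}))))"
proof -
  have win: "window E \<phi> N" and V: "\<And>e. e \<in> E \<Longrightarrow> e \<subseteq> V" using W by (auto simp: windowed_def)
  have inj: "inj_on \<phi> {-N-4..N+4}" using win by (simp add: window_def)
  have offs: "offsets \<subseteq> {-N-4..N+4}" "0 \<in> {-N-4..N+4}" using N by (auto simp: offsets_def)
  have edge: "{\<phi> 0, \<phi> s} \<in> E" if "s \<in> offsets" for s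
    using win that offs by (auto simp: window_def offsets_def)
  have nbr: "\<exists>s\<in>offsets. e = {\<phi> 0, \<phi> s}" if e: "e \<in> E" "\<phi> 0 \<in> e" for e
  proof -
    obtain b where b: "e = {\<phi> 0, b}" using card2[OF e(1)] e(2) by (auto simp: card_2_iff)
    have "0 \<in> {-N..N}" using N by simp
    then have "b \<in> \<phi> ` {-N-4..N+4}" using win e b unfolding window_def by blast
    then obtain s where s: "b = \<phi> s" "s \<in> {-N-4..N+4}" by blast
    have "{\<phi> 0, \<phi> s} \<in> E \<longleftrightarrow> 0 \<noteq> s \<and> \<bar>0 - s\<bar> \<le> 4"
      using win offs(2) s(2) unfolding window_def by blast
    then have "s \<noteq> 0 \<and> \<bar>s\<bar> \<le> 4" using e b s by simp
    then show ?thesis using b s by (intro bexI[of _ s]) (auto simp: offsets_def)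
  qed
  have eq_iff: "{\<phi> 0, \<phi> s} = {\<phi> 0, \<phi> s'} \<longleftrightarrow> s = s'" if "s \<in> offsets" "s' \<in> offsets" for s s'
  proof -
    have "\<phi> s = \<phi> s' \<longleftrightarrow> s = s'" using inj_on_eq_iff[OF inj] that offs by blast
    then show ?thesis by (auto simp: doubleton_eq_iff)
  qed
  define L where "L s = {T \<in> tree_sets V E. {e \<in> T. \<phi> 0 \<in> e} = {{\<phi> 0, \<phi> s}}}" for s
  have L: "tree_sets V (E - star \<phi> (offsets - {s})) = L s" if s: "s \<in> offsets" for s
  proof (intro set_eqI iffI)
    fix T assume T: "T \<in> tree_sets V (E - star \<phi> (offsets - {s}))"
    then have sub: "T \<subseteq> E" "T \<inter> star \<phi> (offsets - {s}) = {}" and conn: "connects T V"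
      by (auto simp: tree_sets_def)
    have "{e \<in> T. \<phi> 0 \<in> e} \<subseteq> {{\<phi> 0, \<phi> s}}" using sub nbr by (fastforce simp: star_def)
    moreover have "{e \<in> T. \<phi> 0 \<in> e} \<noteq> {}"
    proof -
      have "\<phi> 0 \<in> V" "\<phi> s \<in> V" using V edge[OF s] by auto
      then have "(\<phi> 0, \<phi> s) \<in> reach T" using conn by (auto simp: connects_def)
      moreover have "\<phi> 0 \<noteq> \<phi> s" using card2[OF edge[OF s]] by auto
      ultimately obtain b where "(\<phi> 0, b) \<in> adj_pairs T" by (metis converse_rtranclE)
      then show ?thesis by (auto simp: adj_pairs_def)
    qed
    ultimately have "{e \<in> T. \<phi> 0 \<in> e} = {{\<phi> 0, \<phi> s}}" by blast
    then show "T \<in> L s" using T by (auto simp: L_def tree_sets_def)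
  next
    fix T assume T: "T \<in> L s"
    have "e \<notin> star \<phi> (offsets - {s})" if "e \<in> T" for e
    proof
      assume "e \<in> star \<phi> (offsets - {s})"
      then obtain s' where s': "s' \<in> offsets" "s' \<noteq> s" "e = {\<phi> 0, \<phi> s'}" by (auto simp: star_def)
      then have "e \<in> {e \<in> T. \<phi> 0 \<in> e}" using that by auto
      then have "e = {\<phi> 0, \<phi> s}" using T by (auto simp: L_def)
      then show False using s' eq_iff[OF s] by auto
    qed
    then show "T \<in> tree_sets V (E - star \<phi> (offsets - {s}))"
      using T by (auto simp: L_def tree_sets_def)
  qed
  have "leaf_trees V E (\<phi> 0) = (\<Union>s\<in>offsets. L s)"
  proof (intro set_eqI iffI)
    fix T assume "T \<in> leaf_trees V E (\<phi> 0)"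
    then have T: "T \<in> tree_sets V E" "card {e \<in> T. \<phi> 0 \<in> e} = 1" by (auto simp: leaf_trees_def)
    then obtain e where e: "{e \<in> T. \<phi> 0 \<in> e} = {e}" by (auto simp: card_1_singleton_iff)
    then have "e \<in> E" "\<phi> 0 \<in> e" using T by (auto simp: tree_sets_def)
    then obtain s where s: "s \<in> offsets" "e = {\<phi> 0, \<phi> s}" using nbr by blast
    then have "T \<in> L s" using T(1) e by (simp add: L_def)
    then show "T \<in> (\<Union>s\<in>offsets. L s)" using s(1) by blast
  next
    fix T assume "T \<in> (\<Union>s\<in>offsets. L s)"
    then obtain s where "T \<in> tree_sets V E" "{e \<in> T. \<phi> 0 \<in> e} = {{\<phi> 0, \<phi> s}}" unfolding L_def by blast
    then show "T \<in> leaf_trees V E (\<phi> 0)" by (simp add: leaf_trees_def)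
  qed
  also have "card \<dots> = (\<Sum>s\<in>offsets. card (L s))"
  proof (rule card_UN_disjoint)
    show "finite offsets" by (simp add: offsets_def)
    have "L s \<subseteq> tree_sets V E" for s unfolding L_def by blast
    then show "\<forall>s\<in>offsets. finite (L s)"
      using finite_tree_sets[OF windowed_finite(1)[OF W]] finite_subset by blast
    show "\<forall>s\<in>offsets. \<forall>s'\<in>offsets. s \<noteq> s' \<longrightarrow> L s \<inter> L s' = {}"
    proof (intro ballI impI equals0I)
      fix s s' T assume s: "s \<in> offsets" "s' \<in> offsets" "s \<noteq> s'" and "T \<in> L s \<inter> L s'"
      then have "{e \<in> T. \<phi> 0 \<in> e} = {{\<phi> 0, \<phi> s}}" "{e \<in> T. \<phi> 0 \<in> e} = {{\<phi> 0, \<phi> s'}}"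
        by (elim IntE, simp only: L_def mem_Collect_eq)+
      then have "{{\<phi> 0, \<phi> s}} = {{\<phi> 0, \<phi> s'}}" by (rule trans[OF sym])
      then have "{\<phi> 0, \<phi> s} = {\<phi> 0, \<phi> s'}" by (rule singleton_inject)
      then show False using s eq_iff by blast
    qed
  qed
  finally show ?thesis using L by simp
qed

text \<open>
  Eight neighbours with seven deleted edges each give the factor \<open>56\<close>.
\<close>

lemma leaf_probability_close:
  assumes W: "windowed V E \<phi> N" "windowed V' E' \<phi>' N" and N: "N \<ge> 9" and t: "t > 0"
    and card2: "\<And>e. e \<in> E \<Longrightarrow> card e = 2" "\<And>e. e \<in> E' \<Longrightarrow> card e = 2"
  shows "\<bar>real (card (leaf_trees V E (\<phi> 0))) / real (card (tree_sets V E))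
    - real (card (leaf_trees V' E' (\<phi>' 0))) / real (card (tree_sets V' E'))\<bar>
    \<le> 56 * (t + (1 + 1 / t) * 216 / N)"
proof -
  let ?b = "t + (1 + 1 / t) * 216 / real_of_int N"
  have p: "real (card (leaf_trees V E (\<phi> 0))) / real (card (tree_sets V E))
      = (\<Sum>s\<in>offsets. deleted_ratio V E \<phi> (offsets - {s}))"
    by (simp add: card_leaf_trees[OF W(1) N card2(1)] deleted_ratio_def sum_divide_distrib)
  have p': "real (card (leaf_trees V' E' (\<phi>' 0))) / real (card (tree_sets V' E'))
      = (\<Sum>s\<in>offsets. deleted_ratio V' E' \<phi>' (offsets - {s}))"
    by (simp add: card_leaf_trees[OF W(2) N card2(2)] deleted_ratio_def sum_divide_distrib)
  have c8: "card offsets = 8" by (simp add: offsets_def)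
  have "\<bar>(\<Sum>s\<in>offsets. deleted_ratio V E \<phi> (offsets - {s})) - (\<Sum>s\<in>offsets. deleted_ratio V' E' \<phi>' (offsets - {s}))\<bar>
    \<le> (\<Sum>s\<in>offsets. \<bar>deleted_ratio V E \<phi> (offsets - {s}) - deleted_ratio V' E' \<phi>' (offsets - {s})\<bar>)"
    unfolding sum_subtractf[symmetric] by (rule sum_abs)
  also have "\<dots> \<le> (\<Sum>s\<in>offsets. 7 * ?b)"
  proof (rule sum_mono)
    fix s assume s: "s \<in> offsets"
    then have "offsets - {s} \<subset> offsets" by blast
    moreover have "card (offsets - {s}) = 7" using s c8 by (simp add: offsets_def)
    ultimately show "\<bar>deleted_ratio V E \<phi> (offsets - {s}) - deleted_ratio V' E' \<phi>' (offsets - {s})\<bar> \<le> 7 * ?b"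
      using deleted_ratio_close[OF W N _ t, of "offsets - {s}"] by simp
  qed
  also have "\<dots> = 56 * ?b" by (simp add: c8)
  finally show ?thesis by (simp only: p p')
qed

section \<open>Leaves of spanning trees of a graph\<close>

lemma gadj_iff: "simple_ugraph G \<Longrightarrow> gadj G u v \<longleftrightarrow> {u, v} \<in> gedges G"
  by (auto simp: gadj_def simple_ugraph_def)

lemma walk_in_verts:
  assumes "\<And>e. e \<in> E \<Longrightarrow> e \<subseteq> V" "successively (\<lambda>a b. {a, b} \<in> E) xs" "xs \<noteq> []" "hd xs \<in> V"
  shows "set xs \<subseteq> V"
  using assms(2-) by (induction xs rule: induct_list012) (use assms(1) in auto)

lemma gpath_iff_simple_path:
  assumes "simple_ugraph G" "u \<in> gverts G"
  shows "gpath G u xs v \<longleftrightarrow> simple_path (gedges G) u xs v"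
proof -
  have "gadj G = (\<lambda>a b. {a, b} \<in> gedges G)" using gadj_iff[OF assms(1)] by blast
  then show ?thesis
    using walk_in_verts[of "gedges G" "gverts G" xs] assms
    by (auto simp: gpath_def simple_path_def simple_ugraph_def)
qed

lemma gconnected_iff:
  assumes "simple_ugraph G"
  shows "gconnected G \<longleftrightarrow> gverts G \<noteq> {} \<and> connects (gedges G) (gverts G)"
proof -
  have "(\<exists>xs. gpath G u xs v) \<longleftrightarrow> (u, v) \<in> reach (gedges G)" if "u \<in> gverts G" for u v
    using gpath_iff_simple_path[OF assms that] simple_path_of_reach[of u v "gedges G"] reach_of_walk
    by (metis simple_path_def)
  then show ?thesis by (auto simp: gconnected_def connects_def)
qed

text \<open>
  A cycle is an edge together with a simple path between its ends that avoids it.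
\<close>

lemma acyclic_iff_all_bridges:
  assumes G: "simple_ugraph G"
  shows "(\<nexists>xs. gcycle G xs) \<longleftrightarrow> all_bridges (gedges G)"
proof
  assume acyc: "\<nexists>xs. gcycle G xs"
  have "(a, b) \<notin> reach (gedges G - {{a, b}})" if ab: "{a, b} \<in> gedges G" for a b
  proof
    assume "(a, b) \<in> reach (gedges G - {{a, b}})"
    then obtain xs where xs: "simple_path (gedges G - {{a, b}}) a xs b" by (rule simple_path_of_reach)
    have V: "a \<in> gverts G" and "a \<noteq> b" using G ab by (auto simp: simple_ugraph_def)
    have "simple_path (gedges G) a xs b"
      using xs unfolding simple_path_def by (auto elim: successively_mono)
    then have path: "gpath G a xs b" using gpath_iff_simple_path[OF G V] by blast
    have "length xs \<ge> 3"
    proof (rule ccontr)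
      assume "\<not> length xs \<ge> 3"
      then show False using xs \<open>a \<noteq> b\<close>
        by (cases xs rule: remdups_adj.cases) (auto simp: simple_path_def Suc_le_eq)
    qed
    then have "gcycle G xs"
      using path ab by (auto simp: gcycle_def gpath_def gadj_iff[OF G] insert_commute)
    then show False using acyc by blast
  qed
  then show "all_bridges (gedges G)" by (auto simp: all_bridges_def)
next
  assume br: "all_bridges (gedges G)"
  show "\<nexists>xs. gcycle G xs"
  proof
    assume "\<exists>xs. gcycle G xs"
    then obtain xs where xs: "gcycle G xs" by blast
    then have "length xs \<ge> 3" by (simp add: gcycle_def)
    then obtain a zs where "xs = a # zs" "zs \<noteq> []" by (cases xs rule: remdups_adj.cases) auto
    then obtain ys b where eq: "xs = a # ys @ [b]" by (metis append_butlast_last_id)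
    have ys: "ys \<noteq> []" using xs by (auto simp: gcycle_def eq)
    have d: "distinct (a # ys @ [b])" and s: "successively (\<lambda>u v. {u, v} \<in> gedges G) ((a # ys) @ [b])"
      and ab: "{a, b} \<in> gedges G"
      using xs gadj_iff[OF G] by (auto simp: gcycle_def eq insert_commute)
    let ?H = "gedges G - {{a, b}}"
    have "successively (\<lambda>u v. {u, v} \<in> gedges G) (a # ys)" "{last ys, b} \<in> gedges G"
      using s ys by (auto simp: successively_append_iff simp del: append_Cons)
    moreover have "\<not> {a, b} \<subseteq> set (a # ys)" "{last ys, b} \<noteq> {a, b}"
      using d ys last_in_set[OF ys] by (auto simp: doubleton_eq_iff)
    ultimately have "successively (\<lambda>u v. {u, v} \<in> ?H) (a # ys)" "{last ys, b} \<in> ?H"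
      by (blast intro: successively_del_edge)+
    then have "(a, last ys) \<in> reach ?H" "(last ys, b) \<in> reach ?H"
      using reach_of_walk[of "a # ys" ?H] ys by (auto intro: reach_edge)
    then have "(a, b) \<in> reach ?H" by (rule rtrancl_trans)
    then show False using br ab by (auto simp: all_bridges_def)
  qed
qed

lemma spanning_gtrees_eq:
  assumes G: "simple_ugraph G" "gverts G \<noteq> {}"
  shows "spanning_gtrees G = (\<lambda>T. \<lparr>gverts = gverts G, gedges = T\<rparr>) ` tree_sets (gverts G) (gedges G)"
proof -
  have tree: "is_gtree \<lparr>gverts = gverts G, gedges = T\<rparr> \<longleftrightarrow> connects T (gverts G) \<and> all_bridges T"
    if "T \<subseteq> gedges G" for T
  proof -
    have "simple_ugraph \<lparr>gverts = gverts G, gedges = T\<rparr>"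
      using G(1) that by (auto simp: simple_ugraph_def)
    then show ?thesis
      using G(2) by (simp add: is_gtree_def gconnected_iff acyclic_iff_all_bridges[simplified])
  qed
  show ?thesis
  proof (intro set_eqI iffI)
    fix T assume T: "T \<in> spanning_gtrees G"
    then obtain E where E: "T = \<lparr>gverts = gverts G, gedges = E\<rparr>"
      by (cases T) (auto simp: spanning_gtrees_def)
    then have "E \<in> tree_sets (gverts G) (gedges G)"
      using T tree[of E] by (auto simp: spanning_gtrees_def tree_sets_def)
    then show "T \<in> (\<lambda>T. \<lparr>gverts = gverts G, gedges = T\<rparr>) ` tree_sets (gverts G) (gedges G)"
      using E by blast
  qed (use tree in \<open>auto simp: spanning_gtrees_def tree_sets_def\<close>)
qed

definition leaf_probability :: "'a ugraph \<Rightarrow> 'a \<Rightarrow> real" where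
  "leaf_probability G v =
     real (card (leaf_trees (gverts G) (gedges G) v)) / real (card (tree_sets (gverts G) (gedges G)))"

lemma leaf_ratio_eq:
  assumes G: "simple_ugraph (F n)" "gverts (F n) \<noteq> {}"
  shows "leaf_ratio F n = (\<Sum>v\<in>gverts (F n). leaf_probability (F n) v) / real n"
proof -
  let ?V = "gverts (F n)" and ?E = "gedges (F n)"
  let ?X = "tree_sets ?V ?E"
  have fin: "finite ?V" "finite ?E"
    using G(1) by (auto simp: simple_ugraph_def intro: finite_subset[of _ "Pow ?V"])
  have finX: "finite ?X" using fin by (simp add: finite_tree_sets)
  have inj: "inj_on (\<lambda>T. \<lparr>gverts = ?V, gedges = T\<rparr>) ?X" by (auto intro: inj_onI)
  have "(\<Sum>T\<in>spanning_gtrees (F n). real (card (gleaves T)))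
    = (\<Sum>T\<in>?X. real (card {v \<in> ?V. card {e \<in> T. v \<in> e} = 1}))"
    unfolding spanning_gtrees_eq[OF G] by (simp add: sum.reindex[OF inj] gleaves_def gdegree_def)
  also have "\<dots> = (\<Sum>T\<in>?X. \<Sum>v\<in>?V. if card {e \<in> T. v \<in> e} = 1 then 1 else 0)"
    using fin by (simp add: sum.If_cases Int_def)
  also have "\<dots> = (\<Sum>v\<in>?V. \<Sum>T\<in>?X. if card {e \<in> T. v \<in> e} = 1 then 1 else 0)" by (rule sum.swap)
  also have "\<dots> = (\<Sum>v\<in>?V. real (card (leaf_trees ?V ?E v)))"
    using finX by (simp add: sum.If_cases Int_def leaf_trees_def)
  finally have sum: "(\<Sum>T\<in>spanning_gtrees (F n). real (card (gleaves T))) = (\<Sum>v\<in>?V. real (card (leaf_trees ?V ?E v)))" .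
  have "num_spanning_gtrees (F n) = card ?X"
    by (simp add: num_spanning_gtrees_def spanning_gtrees_eq[OF G] card_image[OF inj])
  then show ?thesis
    by (simp add: leaf_ratio_def sum leaf_probability_def sum_divide_distrib[symmetric])
qed

lemma leaf_probability_bounds:
  assumes "simple_ugraph G"
  shows "0 \<le> leaf_probability G v" "leaf_probability G v \<le> 1"
proof -
  have "finite (gedges G)"
    using assms by (auto simp: simple_ugraph_def intro: finite_subset[of _ "Pow (gverts G)"])
  then have "card (leaf_trees (gverts G) (gedges G) v) \<le> card (tree_sets (gverts G) (gedges G))"
    by (intro card_mono finite_tree_sets) (auto simp: leaf_trees_def)
  then show "0 \<le> leaf_probability G v" "leaf_probability G v \<le> 1"
    by (auto simp: leaf_probability_def divide_le_eq)
qed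

section \<open>Fourth powers of paths and cycles\<close>

lemma relpow_of_walk:
  assumes "xs \<noteq> []" "successively (\<lambda>a b. {a, b} \<in> T) xs"
  shows "(hd xs, last xs) \<in> adj_pairs T ^^ (length xs - 1)"
  using assms
proof (induction xs rule: induct_list012)
  case (3 a b xs)
  then have "(b, last (b # xs)) \<in> adj_pairs T ^^ length xs" "(a, b) \<in> adj_pairs T"
    by (auto simp: adj_pairs_def)
  from relpow_Suc_I2[OF this(2,1)] show ?case by (simp del: relpow.simps)
qed auto

lemma relpow_sym: "(u, v) \<in> adj_pairs T ^^ k \<Longrightarrow> (v, u) \<in> adj_pairs T ^^ k"
proof (induction k arbitrary: v)
  case (Suc k)
  then obtain w where "(w, u) \<in> adj_pairs T ^^ k" "(v, w) \<in> adj_pairs T"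
    by (auto simp: adj_pairs_def insert_commute)
  then show ?case by (rule relpow_Suc_I2[rotated])
qed auto

text \<open>
  Distances count simple paths, but a walk of length at most \<open>k\<close> is as good, since shortcuts only
  shorten it. Walks are easier to describe in concrete graphs.
\<close>

lemma gdist_range_iff:
  assumes G: "simple_ugraph G" and u: "u \<in> gverts G"
  shows "1 \<le> gdist G u v \<and> gdist G u v \<le> enat k \<longleftrightarrow> u \<noteq> v \<and> (\<exists>j\<le>k. (u, v) \<in> adj_pairs (gedges G) ^^ j)"
proof
  assume dist: "1 \<le> gdist G u v \<and> gdist G u v \<le> enat k"
  let ?A = "(\<lambda>xs. enat (length xs - 1)) ` {xs. gpath G u xs v}"
  have "?A \<noteq> {}"
  proof
    assume "?A = {}"
    then have "gdist G u v = \<infinity>" by (simp add: gdist_def top_enat_def)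
    then show False using dist by simp
  qed
  then have "Inf ?A \<in> ?A" by (meson ex_in_conv wellorder_InfI)
  then obtain xs where xs: "gpath G u xs v" "gdist G u v = enat (length xs - 1)"
    by (auto simp: gdist_def)
  have "simple_path (gedges G) u xs v" using xs gpath_iff_simple_path[OF G u] by blast
  then have "(u, v) \<in> adj_pairs (gedges G) ^^ (length xs - 1)"
    using relpow_of_walk by (metis simple_path_def)
  moreover have "length xs - 1 \<le> k" using xs dist by simp
  moreover have "u \<noteq> v" using dist gdist_self[OF u] by auto
  ultimately show "u \<noteq> v \<and> (\<exists>j\<le>k. (u, v) \<in> adj_pairs (gedges G) ^^ j)" by blast
next
  assume "u \<noteq> v \<and> (\<exists>j\<le>k. (u, v) \<in> adj_pairs (gedges G) ^^ j)"
  then obtain j where j: "u \<noteq> v" "j \<le> k" "(u, v) \<in> adj_pairs (gedges G) ^^ j" by blast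
  obtain xs where xs: "simple_path (gedges G) u xs v" "length xs \<le> j + 1"
    using simple_path_of_relpow[OF j(3)] by blast
  have "gpath G u xs v" using xs gpath_iff_simple_path[OF G u] by blast
  then have "gdist G u v \<le> enat (length xs - 1)" unfolding gdist_def by (intro INF_lower) simp
  also have "\<dots> \<le> enat k" using xs j by simp
  finally have "gdist G u v \<le> enat k" .
  moreover have "1 \<le> gdist G u v"
    unfolding gdist_def
  proof (rule INF_greatest)
    fix ys assume "ys \<in> {xs. gpath G u xs v}"
    then have "gpath G u ys v" by simp
    then have "length ys \<ge> 2"
      using j(1) by (cases ys rule: remdups_adj.cases) (auto simp: gpath_def Suc_le_eq)
    then show "1 \<le> enat (length ys - 1)" by (simp add: one_enat_def)
  qed
  ultimately show "1 \<le> gdist G u v \<and> gdist G u v \<le> enat k" by blast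
qed

lemma graph_power_edge_iff:
  assumes G: "simple_ugraph G"
  shows "{u, v} \<in> gedges (graph_power G k) \<longleftrightarrow>
    u \<in> gverts G \<and> v \<in> gverts G \<and> u \<noteq> v \<and> (\<exists>j\<le>k. (u, v) \<in> adj_pairs (gedges G) ^^ j)"
proof -
  have "{u, v} \<in> gedges (graph_power G k) \<longleftrightarrow> (\<exists>a b. {u, v} = {a, b} \<and> a \<in> gverts G \<and> b \<in> gverts G \<and>
    (1 \<le> gdist G a b \<and> gdist G a b \<le> enat k))"
    by (simp add: graph_power_def)
  also have "\<dots> \<longleftrightarrow> (\<exists>a b. {u, v} = {a, b} \<and> a \<in> gverts G \<and> b \<in> gverts G \<and>
    (a \<noteq> b \<and> (\<exists>j\<le>k. (a, b) \<in> adj_pairs (gedges G) ^^ j)))"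
    by (simp only: gdist_range_iff[OF G] cong: conj_cong)
  also have "\<dots> \<longleftrightarrow> u \<in> gverts G \<and> v \<in> gverts G \<and> u \<noteq> v \<and> (\<exists>j\<le>k. (u, v) \<in> adj_pairs (gedges G) ^^ j)"
    by (auto simp: doubleton_eq_iff dest: relpow_sym)
  finally show ?thesis .
qed

lemma path_power_edge_iff:
  "{u, v} \<in> gedges (graph_power (path_ugraph n) 4) \<longleftrightarrow> u < n \<and> v < n \<and> u \<noteq> v \<and> \<bar>int u - int v\<bar> \<le> 4"
proof -
  let ?R = "adj_pairs (gedges (path_ugraph n))"
  have R: "(a, b) \<in> ?R \<longleftrightarrow> a < n \<and> b < n \<and> (b = a + 1 \<or> a = b + 1)" for a b
    by (auto simp: adj_pairs_def path_ugraph_def doubleton_eq_iff)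
  have "\<bar>int a - int b\<bar> \<le> int j" if "(a, b) \<in> ?R ^^ j" for a b j
    using that by (induction j arbitrary: b) (auto simp: R, fastforce+)
  then have bound: "\<bar>int u - int v\<bar> \<le> 4" if "(u, v) \<in> ?R ^^ j" "j \<le> 4" for j
    using that by fastforce
  have up: "(a, a + d) \<in> ?R ^^ d" if "a + d < n" for a d
    using that by (induction d) (auto simp: R intro: relcompI)
  have "(u, v) \<in> ?R ^^ nat \<bar>int u - int v\<bar>" if "u < n" "v < n"
  proof (cases "u \<le> v")
    case True
    then show ?thesis using up[of u "v - u"] that by (simp add: nat_diff_distrib)
  next
    case False
    then show ?thesis using relpow_sym[OF up[of v "u - v"]] that by (simp add: nat_diff_distrib)
  qed
  then have "\<exists>j\<le>4. (u, v) \<in> ?R ^^ j" if "u < n" "v < n" "\<bar>int u - int v\<bar> \<le> 4"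
    using that by (intro exI[of _ "nat \<bar>int u - int v\<bar>"]) auto
  then show ?thesis
    unfolding graph_power_edge_iff[OF simple_path_ugraph] using bound by (auto simp: path_ugraph_def)
qed

lemma cycle_power_edge_iff:
  assumes n: "n \<ge> 3"
  shows "{u, v} \<in> gedges (graph_power (cycle_ugraph n) 4) \<longleftrightarrow>
    u < n \<and> v < n \<and> u \<noteq> v \<and> (\<exists>d. \<bar>d\<bar> \<le> 4 \<and> int v = (int u + d) mod int n)"
proof -
  let ?R = "adj_pairs (gedges (cycle_ugraph n))"
  have R: "(a, b) \<in> ?R \<longleftrightarrow> a < n \<and> b < n \<and> (b = (a + 1) mod n \<or> a = (b + 1) mod n)" for a b
    using n by (auto simp: adj_pairs_def cycle_ugraph_def doubleton_eq_iff)
  have down: "int b = (int a - 1) mod int n" if "a = (b + 1) mod n" "b < n" for a b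
  proof -
    have "(int a - 1) mod int n = (int (b + 1) mod int n - 1) mod int n" using that by (simp add: zmod_int)
    also have "\<dots> = int b mod int n" by (simp add: mod_diff_left_eq)
    finally show ?thesis using that by simp
  qed
  have "\<exists>d. \<bar>d\<bar> \<le> int j \<and> int b = (int a + d) mod int n" if "(a, b) \<in> ?R ^^ j" "a < n" for a b j
    using that
  proof (induction j arbitrary: b)
    case 0
    then show ?case by (intro exI[of _ 0]) auto
  next
    case (Suc j)
    then obtain c where c: "(a, c) \<in> ?R ^^ j" "(c, b) \<in> ?R" by auto
    obtain d where d: "\<bar>d\<bar> \<le> int j" "int c = (int a + d) mod int n" using Suc c(1) by blast
    have "b < n" "b = (c + 1) mod n \<or> c = (b + 1) mod n" using c(2) R by auto
    then have "int b = (int c + 1) mod int n \<or> int b = (int c - 1) mod int n"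
      using down by (auto simp: zmod_int ac_simps)
    then have "int b = (int a + (d + 1)) mod int n \<or> int b = (int a + (d - 1)) mod int n"
      unfolding d(2) mod_add_left_eq mod_diff_left_eq by (simp add: algebra_simps)
    then show ?case
    proof
      assume "int b = (int a + (d + 1)) mod int n"
      then show ?thesis using d(1) by (intro exI[of _ "d + 1"]) auto
    next
      assume "int b = (int a + (d - 1)) mod int n"
      then show ?thesis using d(1) by (intro exI[of _ "d - 1"]) auto
    qed
  qed
  then have bound: "\<exists>d. \<bar>d\<bar> \<le> 4 \<and> int v = (int u + d) mod int n" if "(u, v) \<in> ?R ^^ j" "j \<le> 4" "u < n" for j
    using that by (meson order_trans of_nat_le_numeral_iff)
  have up: "(a, (a + d) mod n) \<in> ?R ^^ d" if "a < n" for a d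
  proof (induction d)
    case (Suc d)
    have "((a + d) mod n, (a + Suc d) mod n) \<in> ?R" using n by (auto simp: R mod_Suc_eq)
    then show ?case using Suc by auto
  qed (use that in auto)
  have "\<exists>j\<le>4. (u, v) \<in> ?R ^^ j" if uv: "u < n" "v < n" "\<bar>d\<bar> \<le> 4" "int v = (int u + d) mod int n" for d
  proof (cases "d \<ge> 0")
    case True
    then have "int v = int ((u + nat d) mod n)" using uv by (simp add: zmod_int)
    then have "v = (u + nat d) mod n" by linarith
    then show ?thesis using up[OF uv(1), of "nat d"] uv(3) True by (intro exI[of _ "nat d"]) auto
  next
    case False
    have "(int v + (- d)) mod int n = int u mod int n" unfolding uv(4) by (simp add: mod_simps)
    then have "int u = int ((v + nat (- d)) mod n)" using uv False by (simp add: zmod_int)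
    then have "u = (v + nat (- d)) mod n" by linarith
    then show ?thesis using relpow_sym[OF up[OF uv(2), of "nat (- d)"]] uv(3) False
      by (intro exI[of _ "nat (- d)"]) auto
  qed
  then show ?thesis
    unfolding graph_power_edge_iff[OF simple_cycle_ugraph[OF n]] using bound by (auto simp: cycle_ugraph_def)
qed

lemma gverts_power [simp]:
  "gverts (graph_power (path_ugraph n) k) = {0..<n}" "gverts (graph_power (cycle_ugraph n) k) = {0..<n}"
  by (simp_all add: graph_power_def path_ugraph_def cycle_ugraph_def)

text \<open>
  Both fourth powers contain the path \<open>0, 1, \<dots>, n - 1\<close>.
\<close>

lemma connects_of_consecutive:
  assumes "\<And>i. Suc i < n \<Longrightarrow> {i, Suc i} \<in> E"
  shows "connects E {0..<n}"
proof -
  have "(0, i) \<in> reach E" if "i < n" for i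
    using that
  proof (induction i)
    case (Suc i)
    then have "(0, i) \<in> reach E" "(i, Suc i) \<in> reach E" using assms by (auto intro: reach_edge)
    then show ?case by (rule rtrancl_trans)
  qed simp
  then show ?thesis unfolding connects_def by (meson atLeastLessThan_iff reach_sym rtrancl_trans)
qed

lemma windowed_path_power:
  fixes N :: int
  assumes N: "N \<ge> 9" and v: "int v \<ge> N + 4" "int v + N + 4 < int n"
  shows "windowed {0..<n} (gedges (graph_power (path_ugraph n) 4)) (\<lambda>i. nat (int v + i)) N"
proof -
  let ?E = "gedges (graph_power (path_ugraph n) 4)" and ?\<phi> = "\<lambda>i. nat (int v + i)"
  have sub: "e \<subseteq> {0..<n}" if "e \<in> ?E" for e
    using simple_ugraph_power[OF simple_path_ugraph[of n], of 4] that by (auto simp: simple_ugraph_def)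
  have "connects ?E {0..<n}" by (rule connects_of_consecutive) (auto simp: path_power_edge_iff)
  moreover have "window ?E ?\<phi> N"
    unfolding window_def
  proof (intro conjI ballI allI impI)
    show "inj_on ?\<phi> {-N-4..N+4}" using v by (auto intro!: inj_onI)
    show "{?\<phi> i, ?\<phi> j} \<in> ?E \<longleftrightarrow> i \<noteq> j \<and> \<bar>i - j\<bar> \<le> 4" if "i \<in> {-N-4..N+4}" "j \<in> {-N-4..N+4}" for i j
      unfolding path_power_edge_iff using that v by auto
    show "b \<in> ?\<phi> ` {-N-4..N+4}" if "i \<in> {-N..N}" "{?\<phi> i, b} \<in> ?E" for i b
    proof (rule image_eqI)
      show "b = ?\<phi> (int b - int v)" by simp
      show "int b - int v \<in> {-N-4..N+4}" using that v by (auto simp: path_power_edge_iff)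
    qed
  qed
  ultimately show ?thesis using sub by (auto simp: windowed_def)
qed

text \<open>
  Two indices of the window, shifted by at most \<open>4\<close>, differ by less than \<open>n\<close> when
  \<open>2 * N + 13 \<le> n\<close>, so congruence modulo \<open>n\<close> means equality and the window does not see that the
  cycle closes up.
\<close>

lemma windowed_cycle_power:
  fixes N :: int
  assumes N: "N \<ge> 9" and n: "2 * N + 13 \<le> int n"
  shows "windowed {0..<n} (gedges (graph_power (cycle_ugraph n) 4)) (\<lambda>i. nat ((int v + i) mod int n)) N"
proof -
  let ?E = "gedges (graph_power (cycle_ugraph n) 4)" and ?\<phi> = "\<lambda>i. nat ((int v + i) mod int n)"
  have n3: "n \<ge> 3" and n0: "int n > 0" using N n by auto
  have sub: "e \<subseteq> {0..<n}" if "e \<in> ?E" for e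
    using simple_ugraph_power[OF simple_cycle_ugraph[OF n3], of 4] that by (auto simp: simple_ugraph_def)
  have "connects ?E {0..<n}"
    by (rule connects_of_consecutive) (auto simp: cycle_power_edge_iff[OF n3] intro!: exI[of _ 1])
  moreover have "window ?E ?\<phi> N"
    unfolding window_def
  proof (intro conjI ballI allI impI)
    have int\<phi>: "int (?\<phi> i) = (int v + i) mod int n" for i using n0 by simp
    have lt: "?\<phi> i < n" for i using n0 by (simp add: nat_less_iff)
    have eq: "(int v + i) mod int n = (int v + j) mod int n \<longleftrightarrow> i = j" if "\<bar>i - j\<bar> < int n" for i j
    proof
      assume "(int v + i) mod int n = (int v + j) mod int n"
      then have "int n dvd i - j" by (simp add: mod_eq_dvd_iff)
      then show "i = j" using that by (metis abs_ge_zero dvd_abs_iff eq_iff_diff_eq_0 abs_eq_0 zdvd_not_zless order_le_less)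
    qed simp
    show inj: "inj_on ?\<phi> {-N-4..N+4}"
    proof (rule inj_onI)
      fix i j assume ij: "i \<in> {-N-4..N+4}" "j \<in> {-N-4..N+4}" "?\<phi> i = ?\<phi> j"
      then have "(int v + i) mod int n = (int v + j) mod int n" using int\<phi> by metis
      then show "i = j" using eq[of i j] ij n by auto
    qed
    show "{?\<phi> i, ?\<phi> j} \<in> ?E \<longleftrightarrow> i \<noteq> j \<and> \<bar>i - j\<bar> \<le> 4" if ij: "i \<in> {-N-4..N+4}" "j \<in> {-N-4..N+4}" for i j
    proof -
      have "int (?\<phi> j) = (int (?\<phi> i) + d) mod int n \<longleftrightarrow> j = i + d" if "\<bar>d\<bar> \<le> 4" for d
      proof -
        have "(int (?\<phi> i) + d) mod int n = (int v + (i + d)) mod int n"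
          unfolding int\<phi> by (simp add: mod_simps ac_simps)
        then show ?thesis using eq[of j "i + d"] int\<phi>[of j] ij that n by auto
      qed
      then have "(\<exists>d. \<bar>d\<bar> \<le> 4 \<and> int (?\<phi> j) = (int (?\<phi> i) + d) mod int n) \<longleftrightarrow> (\<exists>d. \<bar>d\<bar> \<le> 4 \<and> j = i + d)"
        by blast
      also have "\<dots> \<longleftrightarrow> \<bar>i - j\<bar> \<le> 4"
      proof
        assume "\<bar>i - j\<bar> \<le> 4"
        then show "\<exists>d. \<bar>d\<bar> \<le> 4 \<and> j = i + d" by (intro exI[of _ "j - i"]) auto
      qed auto
      finally show ?thesis
        using inj_on_eq_iff[OF inj ij] lt unfolding cycle_power_edge_iff[OF n3] by auto
    qed
    show "b \<in> ?\<phi> ` {-N-4..N+4}" if i: "i \<in> {-N..N}" "{?\<phi> i, b} \<in> ?E" for i b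
    proof -
      obtain d where d: "\<bar>d\<bar> \<le> 4" "int b = (int (?\<phi> i) + d) mod int n"
        using i(2) unfolding cycle_power_edge_iff[OF n3] by blast
      then have "int b = (int v + (i + d)) mod int n" unfolding int\<phi> by (simp add: mod_simps ac_simps)
      then have "b = ?\<phi> (i + d)" by (metis nat_int)
      moreover have "i + d \<in> {-N-4..N+4}" using d(1) i(1) by auto
      ultimately show ?thesis by blast
    qed
  qed
  ultimately show ?thesis using sub by (auto simp: windowed_def)
qed

text \<open>
  \<open>B\<close> is an exceptional set; there a value in the unit interval differs from \<open>q\<close> by at most
  \<open>1\<close>.
\<close>

lemma average_close:
  fixes p :: "nat \<Rightarrow> real"
  assumes n: "n > 0" and b: "b \<ge> 0" and q: "0 \<le> q" "q \<le> 1" and p: "\<And>v. 0 \<le> p v" "\<And>v. p v \<le> 1"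
    and close: "\<And>v. v \<in> {0..<n} - B \<Longrightarrow> \<bar>p v - q\<bar> \<le> b"
    and B: "finite B" "card B \<le> m"
  shows "\<bar>(\<Sum>v\<in>{0..<n}. p v) / n - q\<bar> \<le> b + m / n"
proof -
  have "(\<Sum>v\<in>{0..<n}. p v) / n - q = (\<Sum>v\<in>{0..<n}. p v - q) / n"
    using n by (simp add: sum_subtractf field_simps)
  moreover have "\<bar>\<Sum>v\<in>{0..<n}. p v - q\<bar> \<le> n * b + m"
  proof -
    have "\<bar>\<Sum>v\<in>{0..<n}. p v - q\<bar> \<le> (\<Sum>v\<in>{0..<n}. \<bar>p v - q\<bar>)" by (rule sum_abs)
    also have "\<dots> \<le> (\<Sum>v\<in>{0..<n}. b + (if v \<in> B then 1 else 0))"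
    proof (rule sum_mono)
      fix v assume "v \<in> {0..<n}"
      then show "\<bar>p v - q\<bar> \<le> b + (if v \<in> B then 1 else 0)"
        using close[of v] p[of v] q b by (cases "v \<in> B") (auto simp: abs_le_iff)
    qed
    also have "\<dots> = n * b + card ({0..<n} \<inter> B)" by (simp add: sum.distrib sum.If_cases)
    also have "\<dots> \<le> n * b + m"
      using B card_mono[OF B(1), of "{0..<n} \<inter> B"] by auto
    finally show ?thesis .
  qed
  ultimately have "\<bar>(\<Sum>v\<in>{0..<n}. p v) / n - q\<bar> \<le> (n * b + m) / n"
    using n by (simp add: divide_right_mono)
  then show ?thesis using n by (simp add: add_divide_distrib)
qed

text \<open>
  The number \<open>q\<close> is the leaf probability in one fixed large cycle. Every vertex of a longer cycle, and
  every vertex of a long path that is not among the \<open>N + 4\<close> first or last ones, has a window of the same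
  size, hence a leaf probability close to \<open>q\<close>.
\<close>

lemma leaf_ratios_close:
  assumes \<epsilon>: "\<epsilon> > 0"
  shows "\<exists>q n0. \<forall>n\<ge>n0. \<bar>leaf_ratio (\<lambda>n. graph_power (path_ugraph n) 4) n - q\<bar> \<le> \<epsilon> \<and>
    \<bar>leaf_ratio (\<lambda>n. graph_power (cycle_ugraph n) 4) n - q\<bar> \<le> \<epsilon>"
proof -
  let ?P = "\<lambda>n. graph_power (path_ugraph n) 4" and ?C = "\<lambda>n. graph_power (cycle_ugraph n) 4"
  \<comment> \<open>The error \<open>56 * (t + (1 + 1 / t) * 216 / N)\<close> is to be at most \<open>\<epsilon> / 2\<close>: the choice of
    \<open>t\<close> makes its first part \<open>\<epsilon> / 4\<close>, and then \<open>N\<close> bounds the second part by the same amount.\<close>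
  define t where "t = \<epsilon> / 224"
  have t: "t > 0" using \<epsilon> by (simp add: t_def)
  define K where "K = 56 * ((1 + 1 / t) * 216) / (\<epsilon> / 4)"
  define N where "N = max 9 \<lceil>K\<rceil>"
  have N: "N \<ge> 9" "K \<le> N" by (auto simp: N_def) (meson le_of_int_ceiling max.cobounded2 of_int_le_iff order_trans)
  define b where "b = 56 * (t + (1 + 1 / t) * 216 / N)"
  have b0: "0 \<le> b" using t N by (simp add: b_def)
  have b: "b \<le> \<epsilon> / 2"
  proof -
    have "56 * ((1 + 1 / t) * 216) \<le> \<epsilon> / 4 * N" using N(2) \<epsilon> by (simp add: K_def divide_le_eq mult.commute)
    then have "56 * ((1 + 1 / t) * 216) / N \<le> \<epsilon> / 4" using N(1) by (simp add: divide_le_eq)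
    moreover have "b = 56 * t + 56 * ((1 + 1 / t) * 216) / N" by (simp add: b_def)
    moreover have "56 * t = \<epsilon> / 4" by (simp add: t_def)
    ultimately show ?thesis by linarith
  qed
  define r where "r = nat (2 * N + 13)"
  have r: "2 * N + 13 \<le> int r" "r \<ge> 3" using N by (auto simp: r_def)
  have simple: "simple_ugraph (?P n)" "n \<ge> 3 \<Longrightarrow> simple_ugraph (?C n)" for n
    by (auto intro: simple_ugraph_power simple_path_ugraph simple_cycle_ugraph)
  have card2: "e \<in> gedges (?P n) \<Longrightarrow> card e = 2" "n \<ge> 3 \<Longrightarrow> e \<in> gedges (?C n) \<Longrightarrow> card e = 2" for e n
    using simple[of n] by (auto simp: simple_ugraph_def)
  define q where "q = leaf_probability (?C r) 0"
  have q: "0 \<le> q" "q \<le> 1" using leaf_probability_bounds[OF simple(2)[OF r(2)]] by (auto simp: q_def)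
  have Wr: "windowed {0..<r} (gedges (?C r)) (\<lambda>i. nat ((int 0 + i) mod int r)) N"
    by (rule windowed_cycle_power[OF N(1) r(1)])
  have cyc: "\<bar>leaf_probability (?C n) v - q\<bar> \<le> b" if n: "n \<ge> r" and v: "v < n" for n v
  proof -
    have "nat ((int v + 0) mod int n) = v" using v by simp
    then show ?thesis
      using leaf_probability_close[OF windowed_cycle_power[OF N(1), of n v] Wr N(1) t
          card2(2)[of n] card2(2)[of r]] n r
      by (simp add: leaf_probability_def q_def b_def)
  qed
  have path: "\<bar>leaf_probability (?P n) v - q\<bar> \<le> b" if "int v \<ge> N + 4" "int v + N + 4 < int n" for n v
    using leaf_probability_close[OF windowed_path_power[OF N(1) that] Wr N(1) t
        card2(1)[of _ n] card2(2)[of r]] r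
    by (simp add: leaf_probability_def q_def b_def)
  define m where "m = nat (2 * N + 8)"
  define n0 where "n0 = max r (nat \<lceil>real m / (\<epsilon> / 2)\<rceil>)"
  have "\<bar>leaf_ratio ?P n - q\<bar> \<le> \<epsilon> \<and> \<bar>leaf_ratio ?C n - q\<bar> \<le> \<epsilon>" if n: "n \<ge> n0" for n
  proof -
    have nr: "n \<ge> r" "n \<ge> 3" "n > 0" using n r by (auto simp: n0_def)
    have "real m / (\<epsilon> / 2) \<le> n" using n unfolding n0_def by linarith
    then have m: "m / n \<le> \<epsilon> / 2" using \<epsilon> nr by (simp add: field_simps)
    have "leaf_ratio ?C n = (\<Sum>v\<in>{0..<n}. leaf_probability (?C n) v) / n"
      using leaf_ratio_eq[of ?C n] simple(2)[OF nr(2)] nr by simp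
    moreover have "\<bar>(\<Sum>v\<in>{0..<n}. leaf_probability (?C n) v) / n - q\<bar> \<le> b + real 0 / n"
      using leaf_probability_bounds[OF simple(2)[OF nr(2)]] cyc[OF nr(1)]
      by (intro average_close[where B = "{}"] nr b0 q) auto
    ultimately have 1: "\<bar>leaf_ratio ?C n - q\<bar> \<le> \<epsilon>" using b \<epsilon> by simp
    define B where "B = {0..<nat (N + 4)} \<union> {n - nat (N + 4)..<n}"
    have cardB: "card B \<le> m"
    proof -
      have "card B \<le> card {0..<nat (N + 4)} + card {n - nat (N + 4)..<n}" unfolding B_def by (rule card_Un_le)
      also have "\<dots> \<le> m" using N(1) by (simp add: m_def)
      finally show ?thesis .
    qed
    have "leaf_ratio ?P n = (\<Sum>v\<in>{0..<n}. leaf_probability (?P n) v) / n"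
      using leaf_ratio_eq[of ?P n] simple(1)[of n] nr by simp
    moreover have "\<bar>(\<Sum>v\<in>{0..<n}. leaf_probability (?P n) v) / n - q\<bar> \<le> b + m / n"
    proof (intro average_close[where B = B] nr b0 q cardB)
      fix v assume v: "v \<in> {0..<n} - B"
      show "\<bar>leaf_probability (?P n) v - q\<bar> \<le> b"
        by (rule path) (use v N(1) in \<open>auto simp: B_def\<close>)
    qed (use leaf_probability_bounds[OF simple(1)] in \<open>auto simp: B_def\<close>)
    ultimately have "\<bar>leaf_ratio ?P n - q\<bar> \<le> \<epsilon>" using b m by linarith
    with 1 show ?thesis by blast
  qed
  then show ?thesis by blast
qed

theorem theorem6p3p3:
  shows "convergent (leaf_ratio (\<lambda>n. graph_power (path_ugraph n) 4)) \<and>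
         convergent (leaf_ratio (\<lambda>n. graph_power (cycle_ugraph n) 4)) \<and>
         BZ_constant (\<lambda>n. graph_power (path_ugraph n) 4) =
         BZ_constant (\<lambda>n. graph_power (cycle_ugraph n) 4)"
proof -
  let ?a = "leaf_ratio (\<lambda>n. graph_power (path_ugraph n) 4)"
  let ?c = "leaf_ratio (\<lambda>n. graph_power (cycle_ugraph n) 4)"
  \<comment> \<open>The number \<open>q\<close> depends on \<open>\<epsilon>\<close>, so the limit is obtained from the Cauchy criterion.\<close>
  have near: "\<exists>q n0. \<forall>n\<ge>n0. \<bar>?a n - q\<bar> < \<epsilon> \<and> \<bar>?c n - q\<bar> < \<epsilon>" if pos: "\<epsilon> > 0" for \<epsilon>
  proof -
    obtain q n0 where "\<forall>n\<ge>n0. \<bar>?a n - q\<bar> \<le> \<epsilon> / 2 \<and> \<bar>?c n - q\<bar> \<le> \<epsilon> / 2"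
      using leaf_ratios_close[OF half_gt_zero[OF pos]] by blast
    then have "\<forall>n\<ge>n0. \<bar>?a n - q\<bar> < \<epsilon> \<and> \<bar>?c n - q\<bar> < \<epsilon>" using pos by force
    then show ?thesis by blast
  qed
  have "Cauchy ?c"
  proof (rule metric_CauchyI)
    fix \<epsilon> :: real assume "\<epsilon> > 0"
    then obtain q n0 where q: "\<And>n. n \<ge> n0 \<Longrightarrow> \<bar>?c n - q\<bar> < \<epsilon> / 2" using near[of "\<epsilon> / 2"] by auto
    have "dist (?c m) (?c n) < \<epsilon>" if "m \<ge> n0" "n \<ge> n0" for m n
      using q[OF that(1)] q[OF that(2)] unfolding dist_real_def by linarith
    then show "\<exists>M. \<forall>m\<ge>M. \<forall>n\<ge>M. dist (?c m) (?c n) < \<epsilon>" by blast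
  qed
  then obtain l where l: "?c \<longlonglongrightarrow> l" using Cauchy_convergent_iff convergent_def by blast
  have "(\<lambda>n. ?a n - ?c n) \<longlonglongrightarrow> 0"
  proof (rule LIMSEQ_I)
    fix \<epsilon> :: real assume "\<epsilon> > 0"
    then obtain q n0 where q: "\<And>n. n \<ge> n0 \<Longrightarrow> \<bar>?a n - q\<bar> < \<epsilon> / 2 \<and> \<bar>?c n - q\<bar> < \<epsilon> / 2"
      using near[of "\<epsilon> / 2"] by auto
    have "norm (?a n - ?c n - 0) < \<epsilon>" if "n \<ge> n0" for n
      using q[OF that] by (simp, linarith)
    then show "\<exists>n0. \<forall>n\<ge>n0. norm (?a n - ?c n - 0) < \<epsilon>" by blast
  qed
  from tendsto_add[OF this l] have "?a \<longlonglongrightarrow> l" by simp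
  with l show ?thesis by (simp add: BZ_constant_def limI) (blast intro: convergentI)
qed

end
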